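(* Let $r\ge 1$ and $n\ge 1$ be integers, and let $\widehat{H}_{r,n}^{\mathrm{aff}}$ and $\widehat{Y}_{r,n}$ be the $\mathcal{R}$-algebras defined by generators and relations in the context. There is an $\mathcal{R}$-algebra isomorphism $\Phi:\widehat{H}_{r,n}^{\mathrm{aff}}\to\widehat{Y}_{r,n}$ given by $$\Phi(t_j)=\bar t_j\ (1\le j\le n),\qquad \Phi(T_{s_i})=g_i\ (1\le i\le n-1),$$ $$\Phi(T_{s_0})=X_1^{-1}X_n(g_{n-1}\cdots g_2g_1g_2\cdots g_{n-1})^{-1},$$ $$\Phi(T_\rho)=g_{n-1}\cdots g_1X_1,\qquad \Phi(T_\rho^{-1})=X_1^{-1}g_1^{-1}\cdots g_{n-1}^{-1},$$ with the inverse $\Psi:\widehat{Y}_{r,n}\to\widehat{H}_{r,n}^{\mathrm{aff}}$ given by $$\Psi(\bar t_j)=t_j\ (1\le j\le n),\qquad \Psi(g_i)=T_{s_i}\ (1\le i\le n-1),$$ $$\Psi(X_1)=T_{s_1}^{-1}\cdots T_{s_{n-1}}^{-1}T_\rho,\qquad \Psi(X_1^{-1})=T_\rho^{-1}T_{s_{n-1}}\cdots T_{s_1}.$$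
   Context: Let $q$ be an indeterminate and $\mathcal{R}=\mathbb{Z}[\frac1r][q,q^{-1}]$. Algebras are associative and unital. Let $s_i=(i,i+1)$ be the transposition in the symmetric group on $\{1,\dots,n\}$ for $1\le i\le n-1$. For an integer $i$, $\overline{i}\in\{0,1,\dots,n-1\}$ denotes its residue mod $n$. The affine Yokonuma-Hecke algebra $\widehat{Y}_{r,n}$ is the $\mathcal{R}$-algebra generated by $\bar t_1,\dots,\bar t_n,g_1,\dots,g_{n-1},X_1^{\pm1}$ with relations: $g_ig_j=g_jg_i$ for $|i-j|\ge2$; $g_ig_{i+1}g_i=g_{i+1}g_ig_{i+1}$ for $1\le i\le n-2$; $\bar t_i\bar t_j=\bar t_j\bar t_i$ for all $i,j$; $g_i\bar t_j=\bar t_{s_i(j)}g_i$ for $1\le i\le n-1$, $1\le j\le n$; $\bar t_i^{\,r}=1$; $g_i^2=1+(q-q^{-1})\bar e_ig_i$ for $1\le i\le n-1$, where $\bar e_i=\frac1r\sum_{s=0}^{r-1}\bar t_i^{\,s}\bar t_{i+1}^{\,-s}$; $X_1X_1^{-1}=X_1^{-1}X_1=1$; $g_1X_1g_1X_1=X_1g_1X_1g_1$; $g_iX_1=X_1g_i$ for $2\le i\le n-1$; $\bar t_jX_1=X_1\bar t_j$ for $1\le j\le n$. The $g_i$ are invertible with $g_i^{-1}=g_i-(q-q^{-1})\bar e_i$. Define inductively $X_{i+1}:=g_iX_ig_i$ for $1\le i\le n-1$. The algebra $\widehat{H}_{r,n}^{\mathrm{aff}}$ is the $\mathcal{R}$-algebra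 generated by $t_1,\dots,t_n,T_{s_0},\dots,T_{s_{n-1}},T_\rho^{\pm1}$ with relations (where $t_0:=t_n$): $t_i^r=1$; $t_it_j=t_jt_i$; $T_{s_i}t_j=t_{s_i(j)}T_{s_i}$ for $1\le i\le n-1$, $1\le j\le n$; $T_\rho t_j=t_{j-1}T_\rho$ for $1\le j\le n$; $T_\rho T_{s_{\overline i}}=T_{s_{\overline{i-1}}}T_\rho$ for $0\le i\le n-1$; $T_{s_i}T_{s_j}=T_{s_j}T_{s_i}$ if $i-j\not\equiv\pm1\pmod n$; $T_{s_{\overline i}}T_{s_{\overline{i+1}}}T_{s_{\overline i}}=T_{s_{\overline{i+1}}}T_{s_{\overline i}}T_{s_{\overline{i+1}}}$ if $0\le i\le n-1$ and $n\ge3$; $T_{s_i}^2=1+(q-q^{-1})e_iT_{s_i}$ for $0\le i\le n-1$, where $e_i=\frac1r\sum_{s=0}^{r-1}t_i^st_{i+1}^{-s}$; $T_\rho T_\rho^{-1}=T_\rho^{-1}T_\rho=1$. (For $1\le i\le n-1$, $T_{s_i}$ is invertible with inverse $T_{s_i}-(q-q^{-1})e_i$.)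
   Formalization: For n=1 the generator T_{s_0} and its relations are dropped, and the formula for Φ(T_{s_0}) is stated only for n≥2: at n=1 it would give Φ(T_{s_0})=1 with e_0=1, and the quadratic relation would force q=q^{-1}, which is false. *)

theory Defs
  imports
    Complex_Main
    "HOL-Number_Theory.Cong"
    "HOL-Combinatorics.Transposition"
    "HOL-Library.Poly_Mapping"
    "HOL-Algebra.Module"
    "HOL-Algebra.QuotRing"
begin

section \<open>The ground ring\<close>

text \<open>Laurent polynomials over the rationals are the monoid ring \<^typ>\<open>int \<Rightarrow>\<^sub>0 rat\<close>
  of \<open>(\<int>, +)\<close>; the exponent of \<open>q\<close> is the \<^typ>\<open>int\<close> index.
  \<open>\<int>[1/r][q, q\<inverse>]\<close> is the subring of those with coefficients in \<open>\<int>[1/r]\<close>.\<close>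

type_synonym laurent = "int \<Rightarrow>\<^sub>0 rat"

definition int_adjoin_inverse :: "nat \<Rightarrow> rat set" where
  "int_adjoin_inverse r = {of_int a / of_nat r ^ k | (a :: int) (k :: nat). True}"

definition laurent_ring :: "nat \<Rightarrow> laurent set" where
  "laurent_ring r = {f. \<forall>k. Poly_Mapping.lookup f k \<in> int_adjoin_inverse r}"

definition qvar :: laurent where
  "qvar = Poly_Mapping.single 1 1"

definition qvar_inv :: laurent where
  "qvar_inv = Poly_Mapping.single (- 1) 1"

definition recip :: "nat \<Rightarrow> laurent" where
  "recip r = Poly_Mapping.single 0 (1 / of_nat r)"


section \<open>Associative unital algebras given by generators and relations\<close>

text \<open>Words under concatenation, written additively so that the convolution product of
  \<^theory>\<open>HOL-Library.Poly_Mapping\<close> on \<open>'g free_word \<Rightarrow>\<^sub>0 'a\<close> is the product of the free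
  associative algebra on \<open>'g\<close>.\<close>

datatype 'g free_word = Word (letters: "'g list")

instantiation free_word :: (type) monoid_add
begin

definition zero_free_word :: "'a free_word" where
  "0 = Word []"

definition plus_free_word :: "'a free_word \<Rightarrow> 'a free_word \<Rightarrow> 'a free_word" where
  "u + v = Word (letters u @ letters v)"

instance
  by standard (simp_all add: zero_free_word_def plus_free_word_def)

end

definition gen :: "'g \<Rightarrow> 'g free_word \<Rightarrow>\<^sub>0 'a :: comm_ring_1" where
  "gen x = Poly_Mapping.single (Word [x]) 1"

definition scalar :: "'a :: comm_ring_1 \<Rightarrow> 'g free_word \<Rightarrow>\<^sub>0 'a" where
  "scalar c = Poly_Mapping.single 0 c"

text \<open>The free algebra on the generating set \<open>G\<close> over the subring \<open>R\<close> of the ring \<open>'a\<close>.\<close>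

definition free_algebra ::
  "'a :: comm_ring_1 set \<Rightarrow> 'g set \<Rightarrow> ('a, 'g free_word \<Rightarrow>\<^sub>0 'a) module" where
  "free_algebra R G =
    \<lparr>carrier = {f. (\<forall>w. Poly_Mapping.lookup f w \<in> R) \<and>
                   (\<forall>w \<in> Poly_Mapping.keys f. set (letters w) \<subseteq> G)},
     mult = (*), one = 1, zero = 0, add = (+), smult = (\<lambda>c f. scalar c * f)\<rparr>"

text \<open>The quotient ring by a two-sided ideal, with the induced scalar multiplication
  (written like \<^const>\<open>rcoset_mult\<close>).\<close>

definition quotient_algebra ::
  "('a, 'b) module \<Rightarrow> 'b set \<Rightarrow> ('a, 'b set) module" where
  "quotient_algebra A I =
    \<lparr>carrier = carrier (A Quot I), mult = mult (A Quot I), one = one (A Quot I),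
     zero = zero (A Quot I), add = add (A Quot I),
     smult = (\<lambda>c X. \<Union>x\<in>X. I +>\<^bsub>A\<^esub> (c \<odot>\<^bsub>A\<^esub> x))\<rparr>"

text \<open>Here \<open>rel u v\<close> means that \<open>u = v\<close> is a defining relation.\<close>

definition relation_ideal ::
  "'a :: comm_ring_1 set \<Rightarrow> 'g set \<Rightarrow>
   (('g free_word \<Rightarrow>\<^sub>0 'a) \<Rightarrow> ('g free_word \<Rightarrow>\<^sub>0 'a) \<Rightarrow> bool) \<Rightarrow> ('g free_word \<Rightarrow>\<^sub>0 'a) set" where
  "relation_ideal R G rel = Idl\<^bsub>free_algebra R G\<^esub> {u - v | u v. rel u v}"

definition presented_algebra ::
  "'a :: comm_ring_1 set \<Rightarrow> 'g set \<Rightarrow>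
   (('g free_word \<Rightarrow>\<^sub>0 'a) \<Rightarrow> ('g free_word \<Rightarrow>\<^sub>0 'a) \<Rightarrow> bool) \<Rightarrow> ('a, ('g free_word \<Rightarrow>\<^sub>0 'a) set) module" where
  "presented_algebra R G rel = quotient_algebra (free_algebra R G) (relation_ideal R G rel)"

definition presented_gen ::
  "'a :: comm_ring_1 set \<Rightarrow> 'g set \<Rightarrow>
   (('g free_word \<Rightarrow>\<^sub>0 'a) \<Rightarrow> ('g free_word \<Rightarrow>\<^sub>0 'a) \<Rightarrow> bool) \<Rightarrow> 'g \<Rightarrow> ('g free_word \<Rightarrow>\<^sub>0 'a) set" where
  "presented_gen R G rel x = relation_ideal R G rel +>\<^bsub>free_algebra R G\<^esub> gen x"

definition algebra_iso :: "'a set \<Rightarrow> ('a, 'b) module \<Rightarrow> ('a, 'c) module \<Rightarrow> ('b \<Rightarrow> 'c) set" where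
  "algebra_iso R A B =
    {h \<in> ring_iso A B. \<forall>c\<in>R. \<forall>x\<in>carrier A. h (c \<odot>\<^bsub>A\<^esub> x) = c \<odot>\<^bsub>B\<^esub> h x}"

text \<open>Ordered product of a list in a possibly noncommutative ring.\<close>

definition list_prod :: "('a, 'm) monoid_scheme \<Rightarrow> 'a list \<Rightarrow> 'a" where
  "list_prod A xs = foldr (mult A) xs \<one>\<^bsub>A\<^esub>"

text \<open>\<open>(1/r) \<Sum>\<^sub>s a\<^sup>s b\<^sup>-\<^sup>s\<close>. It is only used for generators satisfying \<open>b\<^sup>r = 1\<close>, so that
  \<open>b\<^sup>-\<^sup>s\<close> is \<open>b\<^sup>r\<^sup>-\<^sup>s\<close> for \<open>0 \<le> s < r\<close>.\<close>

definition e_idem :: "nat \<Rightarrow> ('g free_word \<Rightarrow>\<^sub>0 laurent) \<Rightarrow> ('g free_word \<Rightarrow>\<^sub>0 laurent) \<Rightarrow> 'g free_word \<Rightarrow>\<^sub>0 laurent" where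
  "e_idem r a b = scalar (recip r) * (\<Sum>s<r. a ^ s * b ^ (r - s))"


section \<open>The affine Yokonuma--Hecke algebra\<close>

datatype ygen = YT nat | YG nat | YX | YXinv

definition ygens :: "nat \<Rightarrow> ygen set" where
  "ygens n = YT ` {1..n} \<union> YG ` {1..<n} \<union> {YX, YXinv}"

inductive yrel :: "nat \<Rightarrow> nat \<Rightarrow> (ygen free_word \<Rightarrow>\<^sub>0 laurent) \<Rightarrow> (ygen free_word \<Rightarrow>\<^sub>0 laurent) \<Rightarrow> bool"
  for r n :: nat where
  g_comm: "i \<in> {1..<n} \<Longrightarrow> j \<in> {1..<n} \<Longrightarrow> \<bar>int i - int j\<bar> \<ge> 2 \<Longrightarrow>
    yrel r n (gen (YG i) * gen (YG j)) (gen (YG j) * gen (YG i))"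
| g_braid: "1 \<le> i \<Longrightarrow> i + 1 < n \<Longrightarrow>
    yrel r n (gen (YG i) * gen (YG (i + 1)) * gen (YG i))
             (gen (YG (i + 1)) * gen (YG i) * gen (YG (i + 1)))"
| t_comm: "i \<in> {1..n} \<Longrightarrow> j \<in> {1..n} \<Longrightarrow>
    yrel r n (gen (YT i) * gen (YT j)) (gen (YT j) * gen (YT i))"
| g_t: "i \<in> {1..<n} \<Longrightarrow> j \<in> {1..n} \<Longrightarrow>
    yrel r n (gen (YG i) * gen (YT j)) (gen (YT (Transposition.transpose i (i + 1) j)) * gen (YG i))"
| t_pow: "i \<in> {1..n} \<Longrightarrow> yrel r n (gen (YT i) ^ r) 1"
| g_quad: "i \<in> {1..<n} \<Longrightarrow>
    yrel r n (gen (YG i) ^ 2)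
             (1 + scalar (qvar - qvar_inv) * e_idem r (gen (YT i)) (gen (YT (i + 1))) * gen (YG i))"
| X_Xinv: "yrel r n (gen YX * gen YXinv) 1"
| Xinv_X: "yrel r n (gen YXinv * gen YX) 1"
| g_X_braid: "1 < n \<Longrightarrow>
    yrel r n (gen (YG 1) * gen YX * gen (YG 1) * gen YX)
             (gen YX * gen (YG 1) * gen YX * gen (YG 1))"
| g_X: "i \<in> {2..<n} \<Longrightarrow> yrel r n (gen (YG i) * gen YX) (gen YX * gen (YG i))"
| t_X: "j \<in> {1..n} \<Longrightarrow> yrel r n (gen (YT j) * gen YX) (gen YX * gen (YT j))"

definition Yaff :: "nat \<Rightarrow> nat \<Rightarrow> (laurent, (ygen free_word \<Rightarrow>\<^sub>0 laurent) set) module" where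
  "Yaff r n = presented_algebra (laurent_ring r) (ygens n) (yrel r n)"

definition Ygen :: "nat \<Rightarrow> nat \<Rightarrow> ygen \<Rightarrow> (ygen free_word \<Rightarrow>\<^sub>0 laurent) set" where
  "Ygen r n = presented_gen (laurent_ring r) (ygens n) (yrel r n)"

text \<open>\<open>X\<^sub>1, \<dots>, X\<^sub>n\<close>; the value at index 0 is junk.\<close>

primrec YXs :: "nat \<Rightarrow> nat \<Rightarrow> nat \<Rightarrow> (ygen free_word \<Rightarrow>\<^sub>0 laurent) set" where
  "YXs r n 0 = \<one>\<^bsub>Yaff r n\<^esub>"
| "YXs r n (Suc i) =
    (if i = 0 then Ygen r n YX
     else Ygen r n (YG i) \<otimes>\<^bsub>Yaff r n\<^esub> YXs r n i \<otimes>\<^bsub>Yaff r n\<^esub> Ygen r n (YG i))"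


section \<open>The algebra in Iwahori--Matsumoto form\<close>

datatype hgen = HT nat | HS nat | HRho | HRhoinv

text \<open>Indices of the affine simple reflections. For \<open>n = 1\<close> there are none: the affine Weyl
  group of \<open>GL\<^sub>1\<close> is trivial. (Keeping a generator \<open>T\<close> with index 0 for \<open>n = 1\<close> would
  force the quadratic relation on its image \<open>X\<^sub>1\<inverse> X\<^sub>1 = 1\<close>, i.e. \<open>q = q\<inverse>\<close>.)\<close>

definition refl_indices :: "nat \<Rightarrow> nat set" where
  "refl_indices n = (if n = 1 then {} else {0..<n})"

definition hgens :: "nat \<Rightarrow> hgen set" where
  "hgens n = HT ` {1..n} \<union> HS ` refl_indices n \<union> {HRho, HRhoinv}"

text \<open>The convention that the generator \<open>t\<close> with index 0 is the one with index \<open>n\<close>.\<close>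

definition t_index :: "nat \<Rightarrow> nat \<Rightarrow> hgen" where
  "t_index n j = HT (if j = 0 then n else j)"

text \<open>Residues modulo \<open>n\<close> of \<open>i + 1\<close> and of \<open>i - 1\<close> are computed in \<^typ>\<open>nat\<close>,
  the latter as \<open>(i + (n - 1)) mod n\<close>.\<close>

inductive hrel :: "nat \<Rightarrow> nat \<Rightarrow> (hgen free_word \<Rightarrow>\<^sub>0 laurent) \<Rightarrow> (hgen free_word \<Rightarrow>\<^sub>0 laurent) \<Rightarrow> bool"
  for r n :: nat where
  t_pow: "i \<in> {1..n} \<Longrightarrow> hrel r n (gen (HT i) ^ r) 1"
| t_comm: "i \<in> {1..n} \<Longrightarrow> j \<in> {1..n} \<Longrightarrow>
    hrel r n (gen (HT i) * gen (HT j)) (gen (HT j) * gen (HT i))"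
| T_t: "i \<in> {1..<n} \<Longrightarrow> j \<in> {1..n} \<Longrightarrow>
    hrel r n (gen (HS i) * gen (HT j)) (gen (HT (Transposition.transpose i (i + 1) j)) * gen (HS i))"
| rho_t: "j \<in> {1..n} \<Longrightarrow>
    hrel r n (gen HRho * gen (HT j)) (gen (t_index n (j - 1)) * gen HRho)"
| rho_T: "i \<in> refl_indices n \<Longrightarrow>
    hrel r n (gen HRho * gen (HS i)) (gen (HS ((i + (n - 1)) mod n)) * gen HRho)"
| T_comm: "i \<in> refl_indices n \<Longrightarrow> j \<in> refl_indices n \<Longrightarrow>
    \<not> [int i - int j = 1] (mod int n) \<Longrightarrow> \<not> [int i - int j = - 1] (mod int n) \<Longrightarrow>
    hrel r n (gen (HS i) * gen (HS j)) (gen (HS j) * gen (HS i))"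
| T_braid: "i \<in> refl_indices n \<Longrightarrow> n \<ge> 3 \<Longrightarrow>
    hrel r n (gen (HS i) * gen (HS ((i + 1) mod n)) * gen (HS i))
             (gen (HS ((i + 1) mod n)) * gen (HS i) * gen (HS ((i + 1) mod n)))"
| T_quad: "i \<in> refl_indices n \<Longrightarrow>
    hrel r n (gen (HS i) ^ 2)
             (1 + scalar (qvar - qvar_inv) * e_idem r (gen (t_index n i)) (gen (t_index n (i + 1))) * gen (HS i))"
| rho_rhoinv: "hrel r n (gen HRho * gen HRhoinv) 1"
| rhoinv_rho: "hrel r n (gen HRhoinv * gen HRho) 1"

definition Haff :: "nat \<Rightarrow> nat \<Rightarrow> (laurent, (hgen free_word \<Rightarrow>\<^sub>0 laurent) set) module" where
  "Haff r n = presented_algebra (laurent_ring r) (hgens n) (hrel r n)"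

definition Hgen :: "nat \<Rightarrow> nat \<Rightarrow> hgen \<Rightarrow> (hgen free_word \<Rightarrow>\<^sub>0 laurent) set" where
  "Hgen r n = presented_gen (laurent_ring r) (hgens n) (hrel r n)"

end

theory Submission
  imports Defs
begin

text \<open>
  Write \<open>D = g\<^sub>n\<^sub>-\<^sub>1 \<cdots> g\<^sub>1\<close>. On the Bernstein side put \<open>\<rho> = D X\<^sub>1\<close>; conversely \<open>X\<^sub>1 = D\<inverse> \<rho>\<close>. The braid
  relations give \<open>D g\<^sub>i = g\<^sub>i\<^sub>-\<^sub>1 D\<close> for \<open>i \<ge> 2\<close>, so \<open>X\<^sub>1\<close> commutes with \<open>g\<^sub>2, \<dots>, g\<^sub>n\<^sub>-\<^sub>1\<close> iff
  \<open>\<rho> g\<^sub>i = g\<^sub>i\<^sub>-\<^sub>1 \<rho>\<close> for these \<open>i\<close>. Moreover \<open>\<rho>\<^sup>2 = E g\<^sub>1 X\<^sub>1 g\<^sub>1 X\<^sub>1\<close> where \<open>E g\<^sub>1 = g\<^sub>n\<^sub>-\<^sub>1 E\<close>, so the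
  remaining relation \<open>g\<^sub>1 X\<^sub>1 g\<^sub>1 X\<^sub>1 = X\<^sub>1 g\<^sub>1 X\<^sub>1 g\<^sub>1\<close> says exactly that \<open>\<rho>\<^sup>2 g\<^sub>1 = g\<^sub>n\<^sub>-\<^sub>1 \<rho>\<^sup>2\<close>. Setting
  \<open>T\<^sub>0 = \<rho> g\<^sub>1 \<rho>\<inverse>\<close>, conjugation by \<open>\<rho>\<close> therefore permutes the \<open>T\<^sub>i\<close> cyclically, and every relation
  involving \<open>T\<^sub>0\<close> is a \<open>\<rho>\<close>-conjugate of one that does not.
\<close>

section \<open>Algebras over a subring of a commutative ring\<close>

text \<open>Cancelling \<open>D\<close>, \<open>E\<close> and \<open>g_1\<close> needs invertible
  \<open>g_i\<close>, and no relation provides an inverse. It is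
  \<open>g_i - (q - q^-1) e_i\<close>, which is two-sided once \<open>e_i\<close> commutes with
  \<open>g_i\<close>. Since \<open>g_i\<close> swaps \<open>t_i\<close> and \<open>t_(i+1)\<close>,
  this amounts to the symmetry of \<open>e_i\<close> in its two arguments, obtained by replacing
  \<open>s\<close> with \<open>-s\<close> modulo \<open>r\<close> in the sum. The conjugate
  \<open>T_0 = rho g_1 rho^-1\<close> is not the expression in the theorem. Multiplied on the right
  by \<open>g_(n-1) ... g_1 g_2 ... g_(n-1)\<close> it becomes \<open>X_1^-1 X_n\<close>, by the
  relation between \<open>g_1\<close> and \<open>X_1\<close>; this computation is separate from the
  cyclic symmetry. Relations are checked for elements of an arbitrary algebra. Taking the other
  presented algebra gives the two homomorphisms, and they are mutually inverse because both
  composites fix the generators. For \<open>n = 1\<close> the product \<open>D\<close> is empty,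
  \<open>rho = X_1\<close>, and there is no \<open>T_0\<close>.\<close>

locale coeff_subring =
  fixes R :: "'a :: comm_ring_1 set"
  assumes one_mem: "1 \<in> R"
    and diff_mem: "a \<in> R \<Longrightarrow> b \<in> R \<Longrightarrow> a - b \<in> R"
    and mult_mem: "a \<in> R \<Longrightarrow> b \<in> R \<Longrightarrow> a * b \<in> R"
begin

lemma zero_mem: "0 \<in> R"
  using diff_mem[OF one_mem one_mem] by simp

lemma uminus_mem: "a \<in> R \<Longrightarrow> - a \<in> R"
  using diff_mem[OF zero_mem] by fastforce

lemma add_mem: "a \<in> R \<Longrightarrow> b \<in> R \<Longrightarrow> a + b \<in> R"
  using diff_mem[OF _ uminus_mem] by fastforce

end

text \<open>The product need not commute, so compatibility with scalars is required on each side;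
  together the two axioms make scalars act centrally. Scalars range over a set because the ground
  ring \<open>laurent_ring r\<close> depends on \<open>r\<close>.\<close>

locale assoc_algebra = coeff_subring R + ring B
  for R :: "'a :: comm_ring_1 set" and B :: "('a, 'b) module" (structure) +
  assumes smult_closed [simp, intro]:
      "c \<in> R \<Longrightarrow> x \<in> carrier B \<Longrightarrow> c \<odot> x \<in> carrier B"
    and smult_l_distr: "c \<in> R \<Longrightarrow> d \<in> R \<Longrightarrow> x \<in> carrier B \<Longrightarrow> (c + d) \<odot> x = c \<odot> x \<oplus> d \<odot> x"
    and smult_r_distr:
      "c \<in> R \<Longrightarrow> x \<in> carrier B \<Longrightarrow> y \<in> carrier B \<Longrightarrow> c \<odot> (x \<oplus> y) = c \<odot> x \<oplus> c \<odot> y"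
    and smult_assoc: "c \<in> R \<Longrightarrow> d \<in> R \<Longrightarrow> x \<in> carrier B \<Longrightarrow> (c * d) \<odot> x = c \<odot> (d \<odot> x)"
    and smult_one [simp]: "x \<in> carrier B \<Longrightarrow> 1 \<odot> x = x"
    and smult_mult_l:
      "c \<in> R \<Longrightarrow> x \<in> carrier B \<Longrightarrow> y \<in> carrier B \<Longrightarrow> (c \<odot> x) \<otimes> y = c \<odot> (x \<otimes> y)"
    and smult_mult_r:
      "c \<in> R \<Longrightarrow> x \<in> carrier B \<Longrightarrow> y \<in> carrier B \<Longrightarrow> x \<otimes> (c \<odot> y) = c \<odot> (x \<otimes> y)"
begin

lemma smult_zero_left [simp]:
  assumes "x \<in> carrier B"
  shows "0 \<odot> x = \<zero>"
proof -
  have "0 \<odot> x \<oplus> 0 \<odot> x = 0 \<odot> x"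
    using smult_l_distr[OF zero_mem zero_mem assms] by simp
  then show ?thesis
    using assms zero_mem by (metis add.r_cancel_one smult_closed)
qed

end

definition algebra_hom :: "'a set \<Rightarrow> ('a, 'b) module \<Rightarrow> ('a, 'c) module \<Rightarrow> ('b \<Rightarrow> 'c) set" where
  "algebra_hom R A B =
    {h \<in> ring_hom A B. \<forall>c\<in>R. \<forall>x\<in>carrier A. h (c \<odot>\<^bsub>A\<^esub> x) = c \<odot>\<^bsub>B\<^esub> h x}"

lemma algebra_homI:
  assumes "h \<in> ring_hom A B"
    and "\<And>c x. c \<in> R \<Longrightarrow> x \<in> carrier A \<Longrightarrow> h (c \<odot>\<^bsub>A\<^esub> x) = c \<odot>\<^bsub>B\<^esub> h x"
  shows "h \<in> algebra_hom R A B"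
  using assms by (auto simp: algebra_hom_def)

lemma algebra_hom_ring_hom: "h \<in> algebra_hom R A B \<Longrightarrow> h \<in> ring_hom A B"
  by (simp add: algebra_hom_def)

lemma algebra_hom_smult:
  "h \<in> algebra_hom R A B \<Longrightarrow> c \<in> R \<Longrightarrow> x \<in> carrier A \<Longrightarrow> h (c \<odot>\<^bsub>A\<^esub> x) = c \<odot>\<^bsub>B\<^esub> h x"
  by (simp add: algebra_hom_def)

lemma algebra_hom_compose:
  assumes "h \<in> algebra_hom R A B" and "k \<in> algebra_hom R B C"
  shows "k \<circ> h \<in> algebra_hom R A C"
proof (rule algebra_homI)
  show "k \<circ> h \<in> ring_hom A C"
    using assms by (blast intro: ring_hom_trans algebra_hom_ring_hom)
qed (use assms in \<open>auto simp: algebra_hom_def ring_hom_closed\<close>)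

lemma algebra_hom_id: "id \<in> algebra_hom R A A"
  by (auto simp: algebra_hom_def ring_hom_def)

lemma algebra_iso_if_inverse:
  assumes "h \<in> algebra_hom R A B" and "k \<in> algebra_hom R B A"
    and "\<And>x. x \<in> carrier A \<Longrightarrow> k (h x) = x" and "\<And>y. y \<in> carrier B \<Longrightarrow> h (k y) = y"
  shows "h \<in> algebra_iso R A B"
proof -
  have "bij_betw h (carrier A) (carrier B)"
    by (rule bij_betw_byWitness[where f' = k])
      (use assms in \<open>auto simp: algebra_hom_def ring_hom_closed\<close>)
  then show ?thesis
    using assms(1) by (auto simp: algebra_iso_def algebra_hom_def ring_iso_def)
qed


section \<open>Presented algebras\<close>

lemma free_algebra_simps:
  "mult (free_algebra R G) = (*)" "one (free_algebra R G) = 1"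
  "zero (free_algebra R G) = 0" "add (free_algebra R G) = (+)"
  "smult (free_algebra R G) = (\<lambda>c f. scalar c * f)"
  by (simp_all add: free_algebra_def)

lemma in_free_algebra_iff:
  "f \<in> carrier (free_algebra R G) \<longleftrightarrow>
    (\<forall>w. Poly_Mapping.lookup f w \<in> R) \<and> (\<forall>w \<in> Poly_Mapping.keys f. set (letters w) \<subseteq> G)"
  by (simp add: free_algebra_def)

lemma letters_plus [simp]: "letters (u + v) = letters u @ letters v"
  by (simp add: plus_free_word_def)

lemma letters_zero [simp]: "letters 0 = []"
  by (simp add: zero_free_word_def)

text \<open>The empty word is neutral for concatenation and coefficients commute, so the claim is
  clear for a monomial and extends by additivity.\<close>

lemma scalar_mult_commute: "scalar c * f = f * scalar (c :: 'a :: comm_ring_1)"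
proof -
  have "f = (\<Sum>k\<in>Poly_Mapping.keys f. Poly_Mapping.single k (Poly_Mapping.lookup f k))"
    by (rule poly_mapping_eqI)
      (auto simp: lookup_sum lookup_single when_def not_in_keys_iff_lookup_eq_zero)
  moreover have "scalar c * Poly_Mapping.single k d = Poly_Mapping.single k d * scalar c" for k d
    by (simp add: scalar_def mult_single mult.commute)
  ultimately show ?thesis
    by (metis (mono_tags, lifting) sum.cong sum_distrib_left sum_distrib_right)
qed

section \<open>Closure and induction in the free algebra\<close>

context coeff_subring
begin

lemma single_in_free_algebra:
  "c \<in> R \<Longrightarrow> set (letters w) \<subseteq> G \<Longrightarrow> Poly_Mapping.single w c \<in> carrier (free_algebra R G)"
  using zero_mem by (auto simp: in_free_algebra_iff lookup_single when_def)

lemma add_in_free_algebra: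
  assumes "f \<in> carrier (free_algebra R G)" "g \<in> carrier (free_algebra R G)"
  shows "f + g \<in> carrier (free_algebra R G)"
  using assms keys_add[of f g] by (fastforce simp: in_free_algebra_iff lookup_add add_mem)

lemma zero_in_free_algebra: "0 \<in> carrier (free_algebra R G)"
  by (simp add: in_free_algebra_iff zero_mem)

text \<open>One monomial is added per key, and the partial sums stay in the carrier, so the step may
  assume this of \<open>g\<close>. Used once per argument, the rule reduces bilinear claims to
  single words.\<close>

lemma free_algebra_induct [consumes 1, case_names zero add]:
  assumes f: "f \<in> carrier (free_algebra R G)"
    and P0: "P 0"
    and step: "\<And>w c g. c \<in> R \<Longrightarrow> set (letters w) \<subseteq> G \<Longrightarrow> g \<in> carrier (free_algebra R G) \<Longrightarrow> P g \<Longrightarrow>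
      P (Poly_Mapping.single w c + g)"
  shows "P f"
proof -
  define s where "s K = (\<Sum>k\<in>K. Poly_Mapping.single k (Poly_Mapping.lookup f k))" for K
  have "s K \<in> carrier (free_algebra R G) \<and> P (s K)" if "finite K" "K \<subseteq> Poly_Mapping.keys f" for K
    using that
  proof (induction K rule: finite_induct)
    case empty
    then show ?case using P0 by (simp add: s_def zero_in_free_algebra)
  next
    case (insert k K)
    have "s (insert k K) = Poly_Mapping.single k (Poly_Mapping.lookup f k) + s K"
      using insert.hyps by (simp add: s_def)
    moreover have "Poly_Mapping.lookup f k \<in> R" "set (letters k) \<subseteq> G"
      using f insert.prems by (auto simp: in_free_algebra_iff)
    ultimately show ?case
      using insert by (simp add: step add_in_free_algebra single_in_free_algebra)
  qed
  moreover have "s (Poly_Mapping.keys f) = f"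
    by (rule poly_mapping_eqI)
      (auto simp: s_def lookup_sum lookup_single when_def not_in_keys_iff_lookup_eq_zero)
  ultimately show ?thesis
    by (metis finite_keys order_refl)
qed

lemma mult_in_free_algebra:
  assumes f: "f \<in> carrier (free_algebra R G)" and g: "g \<in> carrier (free_algebra R G)"
  shows "f * g \<in> carrier (free_algebra R G)"
  using f
proof (induction rule: free_algebra_induct)
  case (add w c f)
  have "Poly_Mapping.single w c * g \<in> carrier (free_algebra R G)"
    using g
  proof (induction rule: free_algebra_induct)
    case (add v d g)
    then show ?case
      using \<open>c \<in> R\<close> \<open>set (letters w) \<subseteq> G\<close>
      by (simp add: distrib_left mult_single add_in_free_algebra single_in_free_algebra mult_mem)
  qed (simp add: zero_in_free_algebra)
  with add show ?case
    by (simp add: distrib_right add_in_free_algebra)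
qed (simp add: zero_in_free_algebra)

lemma one_in_free_algebra: "1 \<in> carrier (free_algebra R G)"
  using single_in_free_algebra[of 1 0 G] one_mem by simp

lemma scalar_in_free_algebra: "c \<in> R \<Longrightarrow> scalar c \<in> carrier (free_algebra R G)"
  by (simp add: scalar_def single_in_free_algebra)

lemma gen_in_free_algebra: "x \<in> G \<Longrightarrow> gen x \<in> carrier (free_algebra R G)"
  by (simp add: gen_def single_in_free_algebra one_mem)

lemma uminus_in_free_algebra:
  assumes "f \<in> carrier (free_algebra R G)"
  shows "- f \<in> carrier (free_algebra R G)"
  using assms mult_in_free_algebra[OF scalar_in_free_algebra[OF uminus_mem[OF one_mem]]]
  by (auto simp: scalar_def single_uminus)

lemma diff_in_free_algebra:
  assumes "f \<in> carrier (free_algebra R G)" "g \<in> carrier (free_algebra R G)"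
  shows "f - g \<in> carrier (free_algebra R G)"
  using add_in_free_algebra[OF assms(1) uminus_in_free_algebra[OF assms(2)]] by simp

lemma power_in_free_algebra:
  "f \<in> carrier (free_algebra R G) \<Longrightarrow> f ^ k \<in> carrier (free_algebra R G)"
  by (induction k) (simp_all add: one_in_free_algebra mult_in_free_algebra)

lemma sum_in_free_algebra:
  "(\<And>i. i \<in> I \<Longrightarrow> f i \<in> carrier (free_algebra R G)) \<Longrightarrow> sum f I \<in> carrier (free_algebra R G)"
  by (induction I rule: infinite_finite_induct) (simp_all add: zero_in_free_algebra add_in_free_algebra)

lemma free_algebra_ring: "ring (free_algebra R G)"
proof (intro ringI abelian_groupI monoidI)
  fix f assume "f \<in> carrier (free_algebra R G)"
  then show "\<exists>g\<in>carrier (free_algebra R G). g \<oplus>\<^bsub>free_algebra R G\<^esub> f = \<zero>\<^bsub>free_algebra R G\<^esub>"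
    by (intro bexI[of _ "- f"]) (simp_all add: free_algebra_simps uminus_in_free_algebra)
qed (simp_all add: free_algebra_simps zero_in_free_algebra add_in_free_algebra one_in_free_algebra
    mult_in_free_algebra algebra_simps)

text \<open>Relations are given as type class differences \<open>u - v\<close>, whereas cosets and
  kernels are phrased with the subtraction of the ring record.\<close>

lemma free_algebra_minus:
  assumes "f \<in> carrier (free_algebra R G)" "g \<in> carrier (free_algebra R G)"
  shows "f \<ominus>\<^bsub>free_algebra R G\<^esub> g = f - g"
proof -
  interpret F: ring "free_algebra R G" by (rule free_algebra_ring)
  have "\<ominus>\<^bsub>free_algebra R G\<^esub> g = - g"
    using assms(2) by (intro F.minus_equality) (simp_all add: free_algebra_simps uminus_in_free_algebra)
  then show ?thesis
    by (simp add: a_minus_def free_algebra_simps)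
qed

end

text \<open>Substitution of \<open>\<phi>\<close> for the generators: the homomorphism of the
  universal property of the free algebra, as an explicit sum over the support.\<close>

definition free_eval ::
  "('a :: comm_ring_1, 'b) module \<Rightarrow> ('g \<Rightarrow> 'b) \<Rightarrow> ('g free_word \<Rightarrow>\<^sub>0 'a) \<Rightarrow> 'b" where
  "free_eval B \<phi> f =
    (\<Oplus>\<^bsub>B\<^esub>w\<in>Poly_Mapping.keys f. Poly_Mapping.lookup f w \<odot>\<^bsub>B\<^esub> list_prod B (map \<phi> (letters w)))"

lemma list_prod_Nil [simp]: "list_prod B [] = \<one>\<^bsub>B\<^esub>"
  by (simp add: list_prod_def)

lemma list_prod_Cons [simp]: "list_prod B (x # xs) = x \<otimes>\<^bsub>B\<^esub> list_prod B xs"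
  by (simp add: list_prod_def)

context monoid
begin

lemma list_prod_closed [simp, intro]: "set xs \<subseteq> carrier G \<Longrightarrow> list_prod G xs \<in> carrier G"
  by (induction xs) simp_all

lemma list_prod_append:
  "set xs \<subseteq> carrier G \<Longrightarrow> set ys \<subseteq> carrier G \<Longrightarrow>
    list_prod G (xs @ ys) = list_prod G xs \<otimes> list_prod G ys"
  by (induction xs) (simp_all add: m_assoc)

end

context assoc_algebra
begin

context
  fixes G :: "'g set" and \<phi> :: "'g \<Rightarrow> 'b"
  assumes \<phi>: "\<phi> \<in> G \<rightarrow> carrier B"
begin

lemma word_eval_closed: "set xs \<subseteq> G \<Longrightarrow> list_prod B (map \<phi> xs) \<in> carrier B"
  using \<phi> by (intro list_prod_closed) auto

text \<open>Additivity needs \<open>f\<close>, \<open>g\<close> and \<open>f + g\<close> summed over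
  one index set, although cancellation may shrink the support of the sum; the extra words contribute
  zero.\<close>

lemma free_eval_superset:
  assumes "f \<in> carrier (free_algebra R G)" "finite K" "Poly_Mapping.keys f \<subseteq> K"
    "\<And>w. w \<in> K \<Longrightarrow> set (letters w) \<subseteq> G"
  shows "free_eval B \<phi> f =
    (\<Oplus>w\<in>K. Poly_Mapping.lookup f w \<odot> list_prod B (map \<phi> (letters w)))"
  unfolding free_eval_def
  by (rule add.finprod_mono_neutral_cong_left)
    (use assms in \<open>auto simp: in_free_algebra_iff word_eval_closed not_in_keys_iff_lookup_eq_zero\<close>)

lemma free_eval_closed: "f \<in> carrier (free_algebra R G) \<Longrightarrow> free_eval B \<phi> f \<in> carrier B"
  unfolding free_eval_def by (intro finsum_closed) (auto simp: in_free_algebra_iff word_eval_closed)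

lemma free_eval_add:
  assumes "f \<in> carrier (free_algebra R G)" "g \<in> carrier (free_algebra R G)"
  shows "free_eval B \<phi> (f + g) = free_eval B \<phi> f \<oplus> free_eval B \<phi> g"
proof -
  define K where "K = Poly_Mapping.keys f \<union> Poly_Mapping.keys g"
  have K: "finite K" "\<And>w. w \<in> K \<Longrightarrow> set (letters w) \<subseteq> G"
    using assms by (auto simp: K_def in_free_algebra_iff)
  have mem: "Poly_Mapping.lookup f w \<in> R" "Poly_Mapping.lookup g w \<in> R" for w
    using assms by (auto simp: in_free_algebra_iff)
  have "free_eval B \<phi> (f + g) =
      (\<Oplus>w\<in>K. Poly_Mapping.lookup (f + g) w \<odot> list_prod B (map \<phi> (letters w)))"
    using assms K keys_add[of f g]
    by (intro free_eval_superset) (auto simp: add_in_free_algebra K_def)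
  also have "\<dots> = (\<Oplus>w\<in>K. Poly_Mapping.lookup f w \<odot> list_prod B (map \<phi> (letters w)) \<oplus>
      Poly_Mapping.lookup g w \<odot> list_prod B (map \<phi> (letters w)))"
    using K mem by (intro finsum_cong') (auto simp: lookup_add smult_l_distr word_eval_closed)
  also have "\<dots> = (\<Oplus>w\<in>K. Poly_Mapping.lookup f w \<odot> list_prod B (map \<phi> (letters w))) \<oplus>
      (\<Oplus>w\<in>K. Poly_Mapping.lookup g w \<odot> list_prod B (map \<phi> (letters w)))"
    using K mem by (intro finsum_addf) (auto simp: word_eval_closed)
  also have "\<dots> = free_eval B \<phi> f \<oplus> free_eval B \<phi> g"
    using assms K by (subst (1 2) free_eval_superset[of _ K]) (auto simp: K_def)
  finally show ?thesis .
qed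

lemma free_eval_zero: "free_eval B \<phi> 0 = \<zero>"
  by (simp add: free_eval_def)

lemma free_eval_single:
  assumes "c \<in> R" "set (letters w) \<subseteq> G"
  shows "free_eval B \<phi> (Poly_Mapping.single w c) = c \<odot> list_prod B (map \<phi> (letters w))"
  using assms
  by (subst free_eval_superset[of _ "{w}"])
    (auto simp: single_in_free_algebra word_eval_closed split: if_splits)

text \<open>By additivity in each argument it suffices to multiply monomials, where concatenated
  words evaluate to products and scalars move out of either factor.\<close>

lemma free_eval_mult:
  assumes f: "f \<in> carrier (free_algebra R G)" and g: "g \<in> carrier (free_algebra R G)"
  shows "free_eval B \<phi> (f * g) = free_eval B \<phi> f \<otimes> free_eval B \<phi> g"
  using f
proof (induction rule: free_algebra_induct)
  case zero
  then show ?case using g by (simp add: free_eval_zero free_eval_closed)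
next
  case (add w c f)
  note wc = \<open>c \<in> R\<close> \<open>set (letters w) \<subseteq> G\<close>
  have "free_eval B \<phi> (Poly_Mapping.single w c * g) =
      free_eval B \<phi> (Poly_Mapping.single w c) \<otimes> free_eval B \<phi> g"
    using g
  proof (induction rule: free_algebra_induct)
    case zero
    then show ?case using wc by (simp add: free_eval_zero free_eval_closed single_in_free_algebra)
  next
    case (add v d g)
    have "set (map \<phi> (letters w)) \<subseteq> carrier B" "set (map \<phi> (letters v)) \<subseteq> carrier B"
      using add wc \<phi> by auto
    then have "free_eval B \<phi> (Poly_Mapping.single (w + v) (c * d)) =
        free_eval B \<phi> (Poly_Mapping.single w c) \<otimes> free_eval B \<phi> (Poly_Mapping.single v d)"
      using add wc
      by (simp add: free_eval_single mult_mem list_prod_append smult_assoc[symmetric] smult_mult_l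
          smult_mult_r word_eval_closed mult.commute)
    then show ?case
      using add wc
      by (simp add: distrib_left mult_single free_eval_add mult_in_free_algebra
          single_in_free_algebra mult_mem free_eval_closed r_distr)
  qed
  then show ?case
    using add g wc
    by (simp add: distrib_right free_eval_add mult_in_free_algebra single_in_free_algebra
        free_eval_closed l_distr)
qed

lemma free_eval_one: "free_eval B \<phi> 1 = \<one>"
  using free_eval_single[of 1 0] one_mem by simp

lemma free_eval_scalar: "c \<in> R \<Longrightarrow> free_eval B \<phi> (scalar c) = c \<odot> \<one>"
  by (simp add: scalar_def free_eval_single)

lemma free_eval_gen: "x \<in> G \<Longrightarrow> free_eval B \<phi> (gen x) = \<phi> x"
  using \<phi> by (auto simp: gen_def free_eval_single one_mem Pi_iff)

lemma free_eval_hom: "free_eval B \<phi> \<in> algebra_hom R (free_algebra R G) B"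
proof (intro algebra_homI ring_hom_memI)
  fix c f assume c: "c \<in> R" and f: "f \<in> carrier (free_algebra R G)"
  then show "free_eval B \<phi> (c \<odot>\<^bsub>free_algebra R G\<^esub> f) = c \<odot> free_eval B \<phi> f"
    by (simp add: free_algebra_simps free_eval_mult scalar_in_free_algebra free_eval_scalar
        smult_mult_l free_eval_closed)
qed (simp_all add: free_algebra_simps free_eval_closed free_eval_mult free_eval_add free_eval_one)

end

text \<open>Multiplicativity fixes the values on words, and linearity then fixes them
  everywhere.\<close>

lemma free_algebra_hom_unique:
  assumes h: "h \<in> algebra_hom R (free_algebra R G) B" and k: "k \<in> algebra_hom R (free_algebra R G) B"
    and eq: "\<And>x. x \<in> G \<Longrightarrow> h (gen x) = k (gen x)"
    and f: "f \<in> carrier (free_algebra R G)"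
  shows "h f = k f"
proof -
  interpret F: ring "free_algebra R G" by (rule free_algebra_ring)
  interpret h: ring_hom_ring "free_algebra R G" B h
    by (rule ring_hom_ringI2) (use h in \<open>auto simp: algebra_hom_ring_hom free_algebra_ring ring_axioms\<close>)
  interpret k: ring_hom_ring "free_algebra R G" B k
    by (rule ring_hom_ringI2) (use k in \<open>auto simp: algebra_hom_ring_hom free_algebra_ring ring_axioms\<close>)
  have word: "h (Poly_Mapping.single (Word xs) 1) = k (Poly_Mapping.single (Word xs) 1)"
    if "set xs \<subseteq> G" for xs
    using that
  proof (induction xs)
    case Nil
    then show ?case
      using h.hom_one k.hom_one by (simp add: free_algebra_simps zero_free_word_def[symmetric])
  next
    case (Cons x xs)
    have "Poly_Mapping.single (Word (x # xs)) 1 = gen x * Poly_Mapping.single (Word xs) (1 :: 'a)"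
      by (simp add: gen_def mult_single plus_free_word_def)
    then show ?case
      using Cons h.hom_mult[of "gen x" "Poly_Mapping.single (Word xs) 1"]
        k.hom_mult[of "gen x" "Poly_Mapping.single (Word xs) 1"]
      by (simp add: eq free_algebra_simps gen_in_free_algebra single_in_free_algebra one_mem)
  qed
  from f show ?thesis
  proof (induction rule: free_algebra_induct)
    case zero
    then show ?case using h.hom_zero k.hom_zero by (simp add: free_algebra_simps)
  next
    case (add w c f)
    have mem: "Poly_Mapping.single w c \<in> carrier (free_algebra R G)"
      "Poly_Mapping.single w 1 \<in> carrier (free_algebra R G)"
      using add by (simp_all add: single_in_free_algebra one_mem)
    have "Poly_Mapping.single w c = c \<odot>\<^bsub>free_algebra R G\<^esub> Poly_Mapping.single w 1"
      by (simp add: free_algebra_simps scalar_def mult_single)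
    moreover have "h (Poly_Mapping.single w 1) = k (Poly_Mapping.single w 1)"
      using word[of "letters w"] add by simp
    ultimately have "h (Poly_Mapping.single w c) = k (Poly_Mapping.single w c)"
      using algebra_hom_smult[OF h \<open>c \<in> R\<close> mem(2)] algebra_hom_smult[OF k \<open>c \<in> R\<close> mem(2)] by simp
    then show ?case
      using add mem h.hom_add[OF mem(1) add.hyps(3)] k.hom_add[OF mem(1) add.hyps(3)]
      by (simp add: free_algebra_simps)
  qed
qed

end

section \<open>Quotients by the ideal of the defining relations\<close>

locale presentation = coeff_subring R for R :: "'a :: comm_ring_1 set" +
  fixes G :: "'g set" and rel :: "('g free_word \<Rightarrow>\<^sub>0 'a) \<Rightarrow> ('g free_word \<Rightarrow>\<^sub>0 'a) \<Rightarrow> bool"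
  assumes rel_mem: "rel u v \<Longrightarrow> u \<in> carrier (free_algebra R G) \<and> v \<in> carrier (free_algebra R G)"
begin

abbreviation "F \<equiv> free_algebra R G"
abbreviation "I \<equiv> relation_ideal R G rel"
abbreviation "P \<equiv> presented_algebra R G rel"

lemma relation_ideal: "ideal I F"
  unfolding relation_ideal_def
  by (rule ring.genideal_ideal[OF free_algebra_ring]) (use rel_mem in \<open>auto simp: diff_in_free_algebra\<close>)

lemma presented_algebra_simps:
  "carrier P = carrier (F Quot I)" "mult P = mult (F Quot I)" "one P = one (F Quot I)"
  "zero P = zero (F Quot I)" "add P = add (F Quot I)"
  "smult P = (\<lambda>c X. \<Union>x\<in>X. I +>\<^bsub>F\<^esub> (c \<odot>\<^bsub>F\<^esub> x))"
  by (simp_all add: presented_algebra_def quotient_algebra_def)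

lemma presented_ring: "ring P"
proof -
  interpret Q: ring "F Quot I" by (rule ideal.quotient_is_ring[OF relation_ideal])
  show ?thesis
  proof (intro ringI abelian_groupI monoidI)
    fix x assume "x \<in> carrier P"
    then show "\<exists>y\<in>carrier P. y \<oplus>\<^bsub>P\<^esub> x = \<zero>\<^bsub>P\<^esub>"
      using Q.l_neg Q.a_inv_closed by (auto simp: presented_algebra_simps)
  next
    fix x y assume "x \<in> carrier P" "y \<in> carrier P"
    then show "x \<oplus>\<^bsub>P\<^esub> y = y \<oplus>\<^bsub>P\<^esub> x"
      unfolding presented_algebra_simps by (rule Q.a_comm)
  qed (simp_all add: presented_algebra_simps Q.a_assoc Q.m_assoc Q.l_distr Q.r_distr)
qed

lemma proj_ring_hom: "(+>\<^bsub>F\<^esub>) I \<in> ring_hom F P"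
  using ideal.rcos_ring_hom[OF relation_ideal]
  by (simp add: ring_hom_def presented_algebra_simps)

lemma proj_closed: "f \<in> carrier F \<Longrightarrow> I +>\<^bsub>F\<^esub> f \<in> carrier P"
  by (rule ring_hom_closed[OF proj_ring_hom])

lemma presented_cases:
  assumes "x \<in> carrier P"
  obtains f where "f \<in> carrier F" "x = I +>\<^bsub>F\<^esub> f"
  using assms by (auto simp: presented_algebra_simps FactRing_simps)

lemma proj_eq_iff:
  assumes "f \<in> carrier F" "g \<in> carrier F"
  shows "I +>\<^bsub>F\<^esub> f = I +>\<^bsub>F\<^esub> g \<longleftrightarrow> f - g \<in> I"
  using ring.quotient_eq_iff_same_a_r_cos[OF free_algebra_ring relation_ideal assms]
  by (simp add: free_algebra_minus assms)

lemma proj_rel: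
  assumes "rel u v"
  shows "I +>\<^bsub>F\<^esub> u = I +>\<^bsub>F\<^esub> v"
proof -
  have "{u - v | u v. rel u v} \<subseteq> I"
    unfolding relation_ideal_def
    by (rule ring.genideal_self[OF free_algebra_ring]) (use rel_mem in \<open>auto simp: diff_in_free_algebra\<close>)
  then have "u - v \<in> I" using assms by blast
  then show ?thesis using assms rel_mem proj_eq_iff by blast
qed

text \<open>Scalar multiplication on the quotient is a union over all representatives of a coset. It
  collapses to a single coset because the ideal absorbs \<open>scalar c\<close>.\<close>

lemma proj_smult:
  assumes c: "c \<in> R" and f: "f \<in> carrier F"
  shows "c \<odot>\<^bsub>P\<^esub> (I +>\<^bsub>F\<^esub> f) = I +>\<^bsub>F\<^esub> (scalar c * f)"
proof -
  interpret ideal I F by (rule relation_ideal)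
  have eq: "I +>\<^bsub>F\<^esub> (scalar c * x) = I +>\<^bsub>F\<^esub> (scalar c * f)" if x: "x \<in> I +>\<^bsub>F\<^esub> f" for x
  proof -
    have xF: "x \<in> carrier F" using x f by (meson a_elemrcos_carrier)
    have "I +>\<^bsub>F\<^esub> x = I +>\<^bsub>F\<^esub> f"
      using a_repr_independence[OF x f] a_subgroup by simp
    then have "x - f \<in> I" using proj_eq_iff xF f by blast
    then have "scalar c * (x - f) \<in> I"
      using I_l_closed[of "x - f" "scalar c"] c by (simp add: free_algebra_simps scalar_in_free_algebra)
    then show ?thesis
      using xF f c
      by (subst proj_eq_iff) (auto simp: mult_in_free_algebra scalar_in_free_algebra right_diff_distrib)
  qed
  have "f \<in> I +>\<^bsub>F\<^esub> f"
    using f by (rule a_rcos_self)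
  with eq have "(\<Union>x\<in>I +>\<^bsub>F\<^esub> f. I +>\<^bsub>F\<^esub> (scalar c * x)) = I +>\<^bsub>F\<^esub> (scalar c * f)"
    by blast
  then show ?thesis
    by (simp add: presented_algebra_simps free_algebra_simps)
qed

lemma presented_assoc_algebra: "assoc_algebra R P"
proof -
  interpret P: ring P by (rule presented_ring)
  have hom: "I +>\<^bsub>F\<^esub> (f + g) = (I +>\<^bsub>F\<^esub> f) \<oplus>\<^bsub>P\<^esub> (I +>\<^bsub>F\<^esub> g)" "I +>\<^bsub>F\<^esub> (f * g) = (I +>\<^bsub>F\<^esub> f) \<otimes>\<^bsub>P\<^esub> (I +>\<^bsub>F\<^esub> g)"
    if "f \<in> carrier F" "g \<in> carrier F" for f g
    using that ring_hom_add[OF proj_ring_hom] ring_hom_mult[OF proj_ring_hom]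
    by (simp_all add: free_algebra_simps)
  have scalar: "scalar (c + d) = (scalar c + scalar d :: 'g free_word \<Rightarrow>\<^sub>0 'a)"
    "scalar (c * d) = (scalar c * scalar d :: 'g free_word \<Rightarrow>\<^sub>0 'a)" for c d
    by (simp_all add: scalar_def single_add mult_single)
  note mem = scalar_in_free_algebra mult_in_free_algebra add_in_free_algebra
  show ?thesis
  proof unfold_locales
    fix c x assume c: "c \<in> R" and "x \<in> carrier P"
    then obtain f where f: "f \<in> carrier F" "x = I +>\<^bsub>F\<^esub> f" by (blast elim: presented_cases)
    then show "c \<odot>\<^bsub>P\<^esub> x \<in> carrier P"
      using c by (simp add: proj_smult proj_closed mem)
    fix d assume d: "d \<in> R"
    show "(c + d) \<odot>\<^bsub>P\<^esub> x = c \<odot>\<^bsub>P\<^esub> x \<oplus>\<^bsub>P\<^esub> d \<odot>\<^bsub>P\<^esub> x"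
      using f c d by (simp add: proj_smult add_mem mem scalar distrib_right hom(1)[symmetric])
    show "(c * d) \<odot>\<^bsub>P\<^esub> x = c \<odot>\<^bsub>P\<^esub> (d \<odot>\<^bsub>P\<^esub> x)"
      using f c d by (simp add: proj_smult mult_mem mem scalar mult.assoc)
  next
    fix x assume "x \<in> carrier P"
    moreover have "scalar (1 :: 'a) = (1 :: 'g free_word \<Rightarrow>\<^sub>0 'a)" by (simp add: scalar_def)
    ultimately show "1 \<odot>\<^bsub>P\<^esub> x = x"
      by (auto elim!: presented_cases simp: proj_smult one_mem)
  next
    fix c x y assume c: "c \<in> R" and "x \<in> carrier P" "y \<in> carrier P"
    then obtain f g where fg: "f \<in> carrier F" "x = I +>\<^bsub>F\<^esub> f" "g \<in> carrier F" "y = I +>\<^bsub>F\<^esub> g"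
      by (blast elim: presented_cases)
    show "c \<odot>\<^bsub>P\<^esub> (x \<oplus>\<^bsub>P\<^esub> y) = c \<odot>\<^bsub>P\<^esub> x \<oplus>\<^bsub>P\<^esub> c \<odot>\<^bsub>P\<^esub> y"
      using fg c by (simp add: proj_smult mem distrib_left hom(1)[symmetric])
    show "(c \<odot>\<^bsub>P\<^esub> x) \<otimes>\<^bsub>P\<^esub> y = c \<odot>\<^bsub>P\<^esub> (x \<otimes>\<^bsub>P\<^esub> y)"
      using fg c by (simp add: proj_smult mem mult.assoc hom(2)[symmetric])
    show "x \<otimes>\<^bsub>P\<^esub> (c \<odot>\<^bsub>P\<^esub> y) = c \<odot>\<^bsub>P\<^esub> (x \<otimes>\<^bsub>P\<^esub> y)"
      using fg c
      by (simp add: proj_smult mem hom(2)[symmetric] mult.assoc[symmetric] scalar_mult_commute[of c f])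
  qed
qed

sublocale assoc_algebra R P
  by (rule presented_assoc_algebra)

lemma proj_hom: "(+>\<^bsub>F\<^esub>) I \<in> algebra_hom R F P"
  by (rule algebra_homI) (simp_all add: proj_ring_hom proj_smult free_algebra_simps)

lemma presented_gen_closed: "presented_gen R G rel \<in> G \<rightarrow> carrier P"
  by (simp add: presented_gen_def proj_closed gen_in_free_algebra)

text \<open>Substituting the generators of the quotient and projecting are homomorphisms that agree
  on generators. This turns the defining relations into equations inside the quotient.\<close>

lemma free_eval_presented_gen:
  assumes "f \<in> carrier F"
  shows "free_eval P (presented_gen R G rel) f = I +>\<^bsub>F\<^esub> f"
  by (rule free_algebra_hom_unique[OF free_eval_hom[OF presented_gen_closed] proj_hom])
    (simp_all add: assms free_eval_gen[OF presented_gen_closed], simp add: presented_gen_def)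

lemma presented_gen_rel:
  "rel u v \<Longrightarrow> free_eval P (presented_gen R G rel) u = free_eval P (presented_gen R G rel) v"
  using rel_mem proj_rel by (simp add: free_eval_presented_gen)

text \<open>The kernel of the substitution is an ideal containing every \<open>u - v\<close>, hence
  the relation ideal, so the substitution factors through cosets.\<close>

lemma presented_hom_exists:
  assumes B: "assoc_algebra R B" and \<phi>: "\<phi> \<in> G \<rightarrow> carrier B"
    and rel: "\<And>u v. rel u v \<Longrightarrow> free_eval B \<phi> u = free_eval B \<phi> v"
  obtains h where "h \<in> algebra_hom R P B" "\<And>x. x \<in> G \<Longrightarrow> h (presented_gen R G rel x) = \<phi> x"
proof -
  interpret B: assoc_algebra R B by (rule B)
  interpret e: ring_hom_ring F B "free_eval B \<phi>"
    by (rule ring_hom_ringI2)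
      (use B.free_eval_hom[OF \<phi>] in \<open>auto simp: free_algebra_ring B.ring_axioms algebra_hom_ring_hom\<close>)
  have "I \<subseteq> a_kernel F B (free_eval B \<phi>)"
    unfolding relation_ideal_def
  proof (rule ring.genideal_minimal[OF free_algebra_ring e.kernel_is_ideal], clarify)
    fix u v assume uv: "rel u v"
    then have "u \<in> carrier F" "v \<in> carrier F" using rel_mem by auto
    moreover from this have "free_eval B \<phi> (u \<ominus>\<^bsub>F\<^esub> v) = \<zero>\<^bsub>B\<^esub>"
      using rel[OF uv] by (simp add: a_minus_def B.r_neg)
    ultimately have "u - v \<in> carrier F" "free_eval B \<phi> (u - v) = \<zero>\<^bsub>B\<^esub>"
      using free_algebra_minus[of u G v] by (simp_all only: diff_in_free_algebra)
    then show "u - v \<in> a_kernel F B (free_eval B \<phi>)"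
      unfolding a_kernel_def' by blast
  qed
  then have well: "free_eval B \<phi> f = free_eval B \<phi> g"
    if "f \<in> carrier F" "g \<in> carrier F" "I +>\<^bsub>F\<^esub> f = I +>\<^bsub>F\<^esub> g" for f g
  proof -
    have "f - g \<in> a_kernel F B (free_eval B \<phi>)"
      using that \<open>I \<subseteq> _\<close> proj_eq_iff by blast
    then have "free_eval B \<phi> (f \<ominus>\<^bsub>F\<^esub> g) = \<zero>\<^bsub>B\<^esub>"
      using free_algebra_minus[OF that(1,2)] e.kernel_zero by metis
    then have "free_eval B \<phi> f \<ominus>\<^bsub>B\<^esub> free_eval B \<phi> g = \<zero>\<^bsub>B\<^esub>"
      using that(1,2) by (simp add: a_minus_def)
    then show ?thesis
      using B.free_eval_closed[OF \<phi>] that(1,2)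
      by (metis B.a_inv_closed B.minus_eq B.minus_equality B.minus_minus)
  qed
  \<comment> \<open>Any representative may be chosen: by \<open>well\<close> the value depends on
    the coset only.\<close>
  define h where "h X = free_eval B \<phi> (SOME f. f \<in> carrier F \<and> X = I +>\<^bsub>F\<^esub> f)" for X
  have h: "h (I +>\<^bsub>F\<^esub> f) = free_eval B \<phi> f" if "f \<in> carrier F" for f
    unfolding h_def
  proof (rule someI2[of _ f])
    fix g assume "g \<in> carrier F \<and> I +>\<^bsub>F\<^esub> f = I +>\<^bsub>F\<^esub> g"
    then show "free_eval B \<phi> g = free_eval B \<phi> f" using well[of g f] that by simp
  qed (use that in simp)
  have hom: "(I +>\<^bsub>F\<^esub> f) \<oplus>\<^bsub>P\<^esub> (I +>\<^bsub>F\<^esub> g) = I +>\<^bsub>F\<^esub> (f + g)" "(I +>\<^bsub>F\<^esub> f) \<otimes>\<^bsub>P\<^esub> (I +>\<^bsub>F\<^esub> g) = I +>\<^bsub>F\<^esub> (f * g)"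
    if "f \<in> carrier F" "g \<in> carrier F" for f g
    using that ring_hom_add[OF proj_ring_hom] ring_hom_mult[OF proj_ring_hom]
    by (simp_all add: free_algebra_simps)
  have "h \<in> algebra_hom R P B"
  proof (intro algebra_homI ring_hom_memI)
    fix x y assume "x \<in> carrier P" "y \<in> carrier P"
    then obtain f g where fg: "f \<in> carrier F" "x = I +>\<^bsub>F\<^esub> f" "g \<in> carrier F" "y = I +>\<^bsub>F\<^esub> g"
      by (blast elim: presented_cases)
    then show "h (x \<otimes>\<^bsub>P\<^esub> y) = h x \<otimes>\<^bsub>B\<^esub> h y" "h (x \<oplus>\<^bsub>P\<^esub> y) = h x \<oplus>\<^bsub>B\<^esub> h y"
      by (simp_all add: hom h mult_in_free_algebra add_in_free_algebra B.free_eval_mult[OF \<phi>]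
          B.free_eval_add[OF \<phi>])
  next
    fix x assume "x \<in> carrier P"
    then show "h x \<in> carrier B"
      by (auto elim!: presented_cases simp: h B.free_eval_closed[OF \<phi>])
  next
    have "\<one>\<^bsub>P\<^esub> = I +>\<^bsub>F\<^esub> 1"
      using ring_hom_one[OF proj_ring_hom] by (simp add: free_algebra_simps)
    then show "h \<one>\<^bsub>P\<^esub> = \<one>\<^bsub>B\<^esub>"
      by (simp add: h one_in_free_algebra B.free_eval_one[OF \<phi>])
  next
    fix c x assume "c \<in> R" "x \<in> carrier P"
    then show "h (c \<odot>\<^bsub>P\<^esub> x) = c \<odot>\<^bsub>B\<^esub> h x"
      using algebra_hom_smult[OF B.free_eval_hom[OF \<phi>]]
      by (auto elim!: presented_cases
          simp: h proj_smult mult_in_free_algebra scalar_in_free_algebra free_algebra_simps)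
  qed
  moreover have "h (presented_gen R G rel x) = \<phi> x" if "x \<in> G" for x
    using that by (simp add: presented_gen_def h gen_in_free_algebra B.free_eval_gen[OF \<phi>])
  ultimately show ?thesis using that by blast
qed

lemma presented_hom_unique:
  assumes B: "assoc_algebra R B" and h: "h \<in> algebra_hom R P B" and k: "k \<in> algebra_hom R P B"
    and eq: "\<And>x. x \<in> G \<Longrightarrow> h (presented_gen R G rel x) = k (presented_gen R G rel x)"
    and x: "x \<in> carrier P"
  shows "h x = k x"
proof -
  obtain f where f: "f \<in> carrier F" "x = I +>\<^bsub>F\<^esub> f" using x by (rule presented_cases)
  have "(h \<circ> (+>\<^bsub>F\<^esub>) I) f = (k \<circ> (+>\<^bsub>F\<^esub>) I) f"
    by (rule assoc_algebra.free_algebra_hom_unique[OF B algebra_hom_compose[OF proj_hom h]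
          algebra_hom_compose[OF proj_hom k]])
      (use eq f in \<open>auto simp: presented_gen_def\<close>)
  then show ?thesis using f by simp
qed

end

section \<open>Intertwining and braid identities in monoids\<close>

context monoid
begin

text \<open>An equation \<open>c a = a' c\<close> says that conjugation by \<open>c\<close> takes
  \<open>a\<close> to \<open>a'\<close>, without asking \<open>c\<close> to be invertible. In this
  form conjugation passes through products, powers and sums.\<close>

lemma intertwine_mult:
  assumes "c \<otimes> a = a' \<otimes> c" "c \<otimes> b = b' \<otimes> c"
    and "c \<in> carrier G" "a \<in> carrier G" "b \<in> carrier G" "a' \<in> carrier G" "b' \<in> carrier G"
  shows "c \<otimes> (a \<otimes> b) = (a' \<otimes> b') \<otimes> c"
  using assms by (metis m_assoc)

lemma intertwine_pow:
  assumes "c \<otimes> a = a' \<otimes> c" "c \<in> carrier G" "a \<in> carrier G" "a' \<in> carrier G"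
  shows "c \<otimes> a [^] (k :: nat) = a' [^] k \<otimes> c"
  by (induction k) (use assms intertwine_mult in \<open>simp_all\<close>)

lemma intertwine_list_prod:
  assumes "c \<in> carrier G"
    and "\<And>x. x \<in> set xs \<Longrightarrow> u x \<in> carrier G \<and> v x \<in> carrier G \<and> c \<otimes> u x = v x \<otimes> c"
  shows "c \<otimes> list_prod G (map u xs) = list_prod G (map v xs) \<otimes> c"
  using assms(2)
proof (induction xs)
  case (Cons x xs)
  then have "set (map u xs) \<subseteq> carrier G" "set (map v xs) \<subseteq> carrier G" by auto
  with Cons show ?case
    using assms(1) by (simp add: intertwine_mult)
qed (simp add: assms(1))

text \<open>The transport principle for relations: an equation conjugated by a unit remains valid.
  Every relation for \<open>T_0\<close> other than its rotations is obtained this way.\<close>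

lemma intertwine_eq:
  assumes "a = b" "c \<otimes> a = a' \<otimes> c" "c \<otimes> b = b' \<otimes> c"
    and "c \<in> Units G" "a' \<in> carrier G" "b' \<in> carrier G"
  shows "a' = b'"
proof -
  have "a' \<otimes> c \<otimes> inv c = b' \<otimes> c \<otimes> inv c" using assms by simp
  then show ?thesis using assms by (simp add: m_assoc Units_closed)
qed

lemma list_prod_Units: "set xs \<subseteq> Units G \<Longrightarrow> list_prod G xs \<in> Units G"
  by (induction xs) simp_all

lemma inv_mult_Units:
  assumes "x \<in> Units G" "y \<in> Units G"
  shows "inv (x \<otimes> y) = inv y \<otimes> inv x"
proof (rule inv_unique'[symmetric])
  have c: "x \<in> carrier G" "y \<in> carrier G" "inv x \<in> carrier G" "inv y \<in> carrier G"
    using assms by auto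
  have "x \<otimes> y \<otimes> (inv y \<otimes> inv x) = x \<otimes> (y \<otimes> inv y) \<otimes> inv x"
    using c by (simp add: m_assoc del: Units_r_inv)
  then show "x \<otimes> y \<otimes> (inv y \<otimes> inv x) = \<one>" using assms c by simp
  have "inv y \<otimes> inv x \<otimes> (x \<otimes> y) = inv y \<otimes> (inv x \<otimes> x) \<otimes> y"
    using c by (simp add: m_assoc del: Units_l_inv)
  then show "inv y \<otimes> inv x \<otimes> (x \<otimes> y) = \<one>" using assms c by simp
qed (use assms in auto)

lemma inv_list_prod_rev:
  assumes "\<And>x. x \<in> set xs \<Longrightarrow> g x \<in> Units G"
  shows "inv (list_prod G (map g (rev xs))) = list_prod G (map (\<lambda>x. inv (g x)) xs)"
proof -
  have "list_prod G (map (\<lambda>x. inv (g x)) xs) \<otimes> list_prod G (map g (rev xs)) = \<one> \<and>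
    list_prod G (map g (rev xs)) \<otimes> list_prod G (map (\<lambda>x. inv (g x)) xs) = \<one>"
    using assms
  proof (induction xs)
    case (Cons x xs)
    let ?a = "list_prod G (map (\<lambda>x. inv (g x)) xs)" and ?b = "list_prod G (map g (rev xs))"
    have mem: "set (map g (rev xs)) \<subseteq> carrier G" "set (map (\<lambda>x. inv (g x)) xs) \<subseteq> carrier G"
      "g x \<in> Units G" "g x \<in> carrier G"
      using Cons.prems by auto
    have b: "list_prod G (map g (rev (x # xs))) = ?b \<otimes> g x"
      using mem by (simp add: list_prod_append)
    have ab: "?a \<otimes> ?b = \<one>" "?b \<otimes> ?a = \<one>" using Cons by auto
    have ab': "?a \<otimes> (?b \<otimes> y) = y" "?b \<otimes> (?a \<otimes> y) = y" if "y \<in> carrier G" for y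
      using that mem by (simp_all add: m_assoc[symmetric] ab list_prod_closed)
    have g': "g x \<otimes> (inv (g x) \<otimes> y) = y" if "y \<in> carrier G" for y
      using that mem by (simp add: m_assoc[symmetric])
    have c: "?a \<in> carrier G" "?b \<in> carrier G" using mem by auto
    show ?case
      unfolding b using mem c ab by (simp add: m_assoc ab' g')
  qed simp
  moreover have "set (map g (rev xs)) \<subseteq> carrier G" "set (map (\<lambda>x. inv (g x)) xs) \<subseteq> carrier G"
    using assms by auto
  ultimately show ?thesis
    by (intro inv_unique'[symmetric]) auto
qed

end

text \<open>Relations that both presentations share. Instantiated with the images of
  \<open>YG\<close>, \<open>YT\<close> and with those of \<open>HS\<close>, \<open>HT\<close>, the
  locale lets both directions of the isomorphism use the same computations.\<close>

locale braid_torus = monoid M for M (structure) +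
  fixes n :: nat and g t :: "nat \<Rightarrow> 'a"
  assumes g_closed: "i \<in> {1..<n} \<Longrightarrow> g i \<in> carrier M"
    and t_closed: "j \<in> {1..n} \<Longrightarrow> t j \<in> carrier M"
    and g_comm: "i \<in> {1..<n} \<Longrightarrow> j \<in> {1..<n} \<Longrightarrow> \<bar>int i - int j\<bar> \<ge> 2 \<Longrightarrow> g i \<otimes> g j = g j \<otimes> g i"
    and g_braid: "1 \<le> i \<Longrightarrow> i + 1 < n \<Longrightarrow>
      g i \<otimes> g (i + 1) \<otimes> g i = g (i + 1) \<otimes> g i \<otimes> g (i + 1)"
    and g_t: "i \<in> {1..<n} \<Longrightarrow> j \<in> {1..n} \<Longrightarrow>
      g i \<otimes> t j = t (Transposition.transpose i (i + 1) j) \<otimes> g i"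
begin

text \<open>\<open>gprod (rev [1..<k])\<close> is \<open>g_(k-1) ... g_1\<close>; it is
  \<open>D\<close> for \<open>k = n\<close> and the empty product for \<open>k = 1\<close>.\<close>

definition gprod :: "nat list \<Rightarrow> 'a" where
  "gprod xs = list_prod M (map g xs)"

lemma gprod_closed: "set xs \<subseteq> {1..<n} \<Longrightarrow> gprod xs \<in> carrier M"
  unfolding gprod_def by (rule list_prod_closed) (use g_closed in fastforce)

lemma gprod_append:
  "set xs \<subseteq> {1..<n} \<Longrightarrow> set ys \<subseteq> {1..<n} \<Longrightarrow> gprod (xs @ ys) = gprod xs \<otimes> gprod ys"
  unfolding gprod_def map_append using g_closed by (intro list_prod_append) auto

lemma gprod_Cons: "gprod (x # xs) = g x \<otimes> gprod xs"
  by (simp add: gprod_def)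

lemma gprod_single: "x \<in> {1..<n} \<Longrightarrow> gprod [x] = g x"
  by (simp add: gprod_def g_closed)

lemma gprod_descending_Suc: "1 \<le> k \<Longrightarrow> gprod (rev [1..<Suc k]) = g k \<otimes> gprod (rev [1..<k])"
  by (simp add: gprod_Cons)

text \<open>The product lifts the cycle sending 1 to \<open>k\<close> and each other
  \<open>j\<close> up to \<open>k\<close> to \<open>j - 1\<close>. Passing to \<open>k + 1\<close>
  composes this cycle with the transposition of \<open>k\<close> and \<open>k + 1\<close>.\<close>

lemma gprod_descending_t:
  assumes "1 \<le> k" "k \<le> n" "j \<in> {1..n}"
  shows "gprod (rev [1..<k]) \<otimes> t j =
    t (if j = 1 then k else if j \<le> k then j - 1 else j) \<otimes> gprod (rev [1..<k])"
  using assms(1,2)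
proof (induction k rule: dec_induct)
  case base
  then show ?case using assms(3) by (auto simp: gprod_def t_closed)
next
  case (step k)
  let ?s = "\<lambda>k. if j = 1 then k else if j \<le> k then j - 1 else j"
  let ?D = "gprod (rev [1..<k])"
  have mem: "g k \<in> carrier M" "?D \<in> carrier M" "t j \<in> carrier M" "t (?s k) \<in> carrier M"
      "t (?s (Suc k)) \<in> carrier M"
    using step assms(3) by (auto intro!: g_closed gprod_closed t_closed)
  have "transpose k (k + 1) (?s k) = ?s (Suc k)"
    using step assms(3) by (auto simp: Transposition.transpose_def)
  moreover have "?s k \<in> {1..n}"
    using step assms(3) by auto
  ultimately have "g k \<otimes> t (?s k) = t (?s (Suc k)) \<otimes> g k"
    using g_t[of k "?s k"] step by simp
  moreover have "?D \<otimes> t j = t (?s k) \<otimes> ?D"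
    using step by simp
  ultimately have "g k \<otimes> ?D \<otimes> t j = t (?s (Suc k)) \<otimes> (g k \<otimes> ?D)"
    using mem by (metis m_assoc)
  then show ?case
    using step.hyps gprod_descending_Suc by simp
qed

text \<open>A single braid move lowers the index: letters below \<open>i - 1\<close> commute with
  \<open>g_i\<close>, and letters above \<open>i\<close> commute with the resulting
  \<open>g_(i-1)\<close>.\<close>

lemma gprod_descending_g:
  assumes "2 \<le> i" "i < k" "k \<le> n"
  shows "gprod (rev [1..<k]) \<otimes> g i = g (i - 1) \<otimes> gprod (rev [1..<k])"
proof -
  have "Suc i \<le> k" using assms by simp
  then show ?thesis
    using \<open>k \<le> n\<close>
  proof (induction k rule: dec_induct)
    case base
    \<comment> \<open>This tail is \<open>g_(i-2) ... g_1\<close>, empty for \<open>i = 2\<close>;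
      its letters are at distance at least 2 from \<open>i\<close>.\<close>
    let ?D = "gprod (rev [1..<i - 1])"
    obtain m where m: "i = Suc (Suc m)" using assms(1) by (metis add_2_eq_Suc le_Suc_ex)
    have mem: "g i \<in> carrier M" "g (i - 1) \<in> carrier M" "?D \<in> carrier M"
      using base assms(1) by (auto intro!: g_closed gprod_closed)
    have eq: "gprod (rev [1..<Suc i]) = g i \<otimes> (g (i - 1) \<otimes> ?D)"
      using m by (simp add: gprod_Cons)
    have "?D \<otimes> g i = g i \<otimes> ?D"
      unfolding gprod_def
      by (rule sym, rule intertwine_list_prod)
        (use base assms(1) in \<open>auto intro!: g_closed g_comm\<close>)
    then have "gprod (rev [1..<Suc i]) \<otimes> g i = (g i \<otimes> g (i - 1) \<otimes> g i) \<otimes> ?D"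
      unfolding eq using mem by (simp add: m_assoc)
    also have "g i \<otimes> g (i - 1) \<otimes> g i = g (i - 1) \<otimes> g i \<otimes> g (i - 1)"
      using g_braid[of "i - 1"] m base by simp
    also have "\<dots> \<otimes> ?D = g (i - 1) \<otimes> gprod (rev [1..<Suc i])"
      unfolding eq using mem by (simp add: m_assoc)
    finally show ?case .
  next
    case (step k)
    let ?D = "gprod (rev [1..<k])"
    have mem: "g i \<in> carrier M" "g (i - 1) \<in> carrier M" "?D \<in> carrier M" "g k \<in> carrier M"
      using step assms(1) by (auto intro!: g_closed gprod_closed)
    have "g k \<otimes> g (i - 1) = g (i - 1) \<otimes> g k"
      using step assms(1) by (intro g_comm) auto
    moreover have "?D \<otimes> g i = g (i - 1) \<otimes> ?D"
      using step by simp
    ultimately have "g k \<otimes> ?D \<otimes> g i = g (i - 1) \<otimes> (g k \<otimes> ?D)"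
      using mem by (metis m_assoc)
    then show ?case
      using step.hyps assms(1) gprod_descending_Suc by simp
  qed
qed

lemma gprod_descending_split: "n \<ge> 2 \<Longrightarrow> gprod (rev [1..<n]) = gprod (rev [2..<n]) \<otimes> g 1"
  using gprod_append[of "rev [2..<n]" "[1]"] gprod_single[of 1] upt_conv_Cons[of 1 n]
  by (simp add: numeral_2_eq_2)

lemma gprod_ascending_split: "n \<ge> 2 \<Longrightarrow> gprod [1..<n] = g 1 \<otimes> gprod [2..<n]"
  using upt_conv_Cons[of 1 n] by (simp add: gprod_Cons numeral_2_eq_2)

text \<open>Each \<open>g_i\<close> with \<open>i\<close> at least 2 loses one from its index when
  \<open>D\<close> is moved past it.\<close>

lemma gprod_descending_shift:
  assumes "n \<ge> 2"
  shows "gprod (rev [1..<n]) \<otimes> gprod (rev [2..<n]) = gprod (rev [1..<n - 1]) \<otimes> gprod (rev [1..<n])"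
proof -
  have "gprod (rev [1..<n]) \<otimes> list_prod M (map g (rev [2..<n])) =
      list_prod M (map (\<lambda>i. g (i - 1)) (rev [2..<n])) \<otimes> gprod (rev [1..<n])"
    by (rule intertwine_list_prod)
      (use gprod_descending_g[of _ n] in \<open>auto intro!: gprod_closed g_closed\<close>)
  moreover have "map (\<lambda>i. i - 1) [2..<n] = [1..<n - 1]"
    using assms by (intro nth_equalityI) auto
  then have "map (\<lambda>i. g (i - 1)) (rev [2..<n]) = map g (rev [1..<n - 1])"
    by (metis (mono_tags, lifting) comp_apply list.map_comp map_eq_conv rev_map)
  ultimately show ?thesis
    by (simp add: gprod_def)
qed

text \<open>The element \<open>E\<close> with \<open>\<rho>\<^sup>2 = E g\<^sub>1 X\<^sub>1 g\<^sub>1 X\<^sub>1\<close>.\<close>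

definition gcycle2 :: 'a where
  "gcycle2 = gprod (rev [1..<n - 1]) \<otimes> gprod (rev [2..<n])"

text \<open>Put \<open>A = g_(n-1) ... g_2\<close> and \<open>B = g_(n-2) ... g_1\<close>, so that
  \<open>E = B A\<close>. The left side is \<open>D A\<close>, the right side is \<open>B D\<close>,
  and the shift identity equates them.\<close>

lemma gcycle2_g:
  assumes "n \<ge> 2"
  shows "g (n - 1) \<otimes> gcycle2 = gcycle2 \<otimes> g 1"
proof -
  let ?D = "gprod (rev [1..<n])" and ?A = "gprod (rev [2..<n])" and ?B = "gprod (rev [1..<n - 1])"
  have mem: "?D \<in> carrier M" "?A \<in> carrier M" "?B \<in> carrier M" "g 1 \<in> carrier M" "g (n - 1) \<in> carrier M"
    using assms by (auto intro!: gprod_closed g_closed)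
  have "?D = g (n - 1) \<otimes> ?B"
    using gprod_descending_Suc[of "n - 1"] assms by simp
  then have "g (n - 1) \<otimes> gcycle2 = ?D \<otimes> ?A"
    using mem by (simp add: gcycle2_def m_assoc)
  also have "\<dots> = ?B \<otimes> ?D"
    by (rule gprod_descending_shift[OF assms])
  also have "?D = ?A \<otimes> g 1"
    by (rule gprod_descending_split[OF assms])
  also have "?B \<otimes> (?A \<otimes> g 1) = gcycle2 \<otimes> g 1"
    using mem by (simp add: gcycle2_def m_assoc)
  finally show ?thesis .
qed

section \<open>Products of \<open>D\<close> with an element commuting with
  \<open>g_2, ..., g_(n-1)\<close>\<close>

context
  fixes X :: 'a
  assumes X_closed: "X \<in> carrier M"
    and g_X: "i \<in> {2..<n} \<Longrightarrow> g i \<otimes> X = X \<otimes> g i"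
begin

lemma rho_g:
  assumes "i \<in> {2..<n}"
  shows "(gprod (rev [1..<n]) \<otimes> X) \<otimes> g i = g (i - 1) \<otimes> (gprod (rev [1..<n]) \<otimes> X)"
proof -
  have mem: "gprod (rev [1..<n]) \<in> carrier M" "g i \<in> carrier M" "g (i - 1) \<in> carrier M"
    using assms by (auto intro!: gprod_closed g_closed)
  then show ?thesis
    using gprod_descending_g[of i n] g_X[of i] X_closed assms by (metis atLeastLessThan_iff m_assoc order_refl)
qed

text \<open>The second \<open>D\<close> splits as \<open>A g_1\<close> with
  \<open>A = g_(n-1) ... g_2\<close>. Then \<open>X\<close> moves past \<open>A\<close>, the product
  \<open>D A\<close> becomes \<open>B D\<close> with \<open>B = g_(n-2) ... g_1\<close>, and this
  \<open>D\<close> again ends in \<open>g_1\<close>.\<close>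

lemma rho_squared:
  assumes "n \<ge> 2"
  shows "(gprod (rev [1..<n]) \<otimes> X) \<otimes> (gprod (rev [1..<n]) \<otimes> X) = gcycle2 \<otimes> (g 1 \<otimes> X \<otimes> g 1 \<otimes> X)"
proof -
  let ?D = "gprod (rev [1..<n])" and ?A = "gprod (rev [2..<n])" and ?B = "gprod (rev [1..<n - 1])"
  have mem: "?D \<in> carrier M" "?A \<in> carrier M" "?B \<in> carrier M" "g 1 \<in> carrier M"
    using assms by (auto intro!: gprod_closed g_closed)
  have AX: "X \<otimes> ?A = ?A \<otimes> X"
    unfolding gprod_def by (rule intertwine_list_prod) (auto simp: X_closed g_X intro!: g_closed)
  have DA: "?D = ?A \<otimes> g 1" using assms by (rule gprod_descending_split)
  have "(?D \<otimes> X) \<otimes> (?D \<otimes> X) = ?D \<otimes> (X \<otimes> ?A) \<otimes> (g 1 \<otimes> X)"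
    using mem X_closed unfolding DA by (simp add: m_assoc)
  also have "\<dots> = (?D \<otimes> ?A) \<otimes> (X \<otimes> (g 1 \<otimes> X))"
    using mem X_closed by (simp add: AX m_assoc)
  also have "\<dots> = (?B \<otimes> (?A \<otimes> g 1)) \<otimes> (X \<otimes> (g 1 \<otimes> X))"
    using gprod_descending_shift[OF assms] DA by simp
  also have "\<dots> = gcycle2 \<otimes> (g 1 \<otimes> X \<otimes> g 1 \<otimes> X)"
    using mem X_closed by (simp add: gcycle2_def m_assoc)
  finally show ?thesis .
qed

text \<open>The braid relation makes \<open>Z = g_1 X g_1 X\<close> commute with \<open>g_1\<close>,
  while \<open>E\<close> carries \<open>g_1\<close> to \<open>g_(n-1)\<close>.\<close>

lemma rho_squared_g:
  assumes n: "n \<ge> 2" and braid: "g 1 \<otimes> X \<otimes> g 1 \<otimes> X = X \<otimes> g 1 \<otimes> X \<otimes> g 1"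
  shows "(gprod (rev [1..<n]) \<otimes> X) \<otimes> (gprod (rev [1..<n]) \<otimes> X) \<otimes> g 1 =
    g (n - 1) \<otimes> ((gprod (rev [1..<n]) \<otimes> X) \<otimes> (gprod (rev [1..<n]) \<otimes> X))"
proof -
  have mem: "gcycle2 \<in> carrier M" "g 1 \<in> carrier M" "g (n - 1) \<in> carrier M"
    using n by (auto simp: gcycle2_def intro!: gprod_closed g_closed m_closed)
  let ?Z = "g 1 \<otimes> X \<otimes> g 1 \<otimes> X"
  have "?Z \<otimes> g 1 = g 1 \<otimes> (X \<otimes> g 1 \<otimes> X \<otimes> g 1)"
    using mem X_closed by (simp add: m_assoc)
  then have Z: "?Z \<otimes> g 1 = g 1 \<otimes> ?Z"
    using braid by simp
  have "gcycle2 \<otimes> ?Z \<otimes> g 1 = gcycle2 \<otimes> g 1 \<otimes> ?Z"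
    using mem X_closed Z by (metis m_assoc m_closed)
  also have "\<dots> = g (n - 1) \<otimes> (gcycle2 \<otimes> ?Z)"
    unfolding gcycle2_g[OF n, symmetric] using mem X_closed by (intro m_assoc m_closed)
  finally show ?thesis
    unfolding rho_squared[OF n] .
qed

text \<open>Cancelling \<open>E\<close> shows that \<open>Z = g_1 X g_1 X\<close> commutes with
  \<open>g_1\<close>; cancelling the leading \<open>g_1\<close> from \<open>Z g_1 = g_1 Z\<close>
  leaves the braid relation. Both cancellations rest on the \<open>g_i\<close> being units.\<close>

lemma braid_if_rho_squared_g:
  assumes n: "n \<ge> 2" and units: "\<And>i. i \<in> {1..<n} \<Longrightarrow> g i \<in> Units M"
    and rho: "(gprod (rev [1..<n]) \<otimes> X) \<otimes> (gprod (rev [1..<n]) \<otimes> X) \<otimes> g 1 =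
      g (n - 1) \<otimes> ((gprod (rev [1..<n]) \<otimes> X) \<otimes> (gprod (rev [1..<n]) \<otimes> X))"
  shows "g 1 \<otimes> X \<otimes> g 1 \<otimes> X = X \<otimes> g 1 \<otimes> X \<otimes> g 1"
proof -
  have unit: "gcycle2 \<in> Units M" "g 1 \<in> Units M"
    using n units by (auto simp: gcycle2_def gprod_def intro!: Units_m_closed list_prod_Units)
  then have mem: "gcycle2 \<in> carrier M" "g 1 \<in> carrier M" "g (n - 1) \<in> carrier M"
    using n by (auto intro!: g_closed)
  let ?Z = "g 1 \<otimes> X \<otimes> g 1 \<otimes> X"
  have "gcycle2 \<otimes> (?Z \<otimes> g 1) = gcycle2 \<otimes> ?Z \<otimes> g 1"
    using mem X_closed by (simp add: m_assoc)
  also have "\<dots> = g (n - 1) \<otimes> (gcycle2 \<otimes> ?Z)"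
    using rho unfolding rho_squared[OF n] .
  also have "\<dots> = gcycle2 \<otimes> g 1 \<otimes> ?Z"
    unfolding gcycle2_g[OF n, symmetric] using mem X_closed by (intro m_assoc[symmetric] m_closed)
  also have "\<dots> = gcycle2 \<otimes> (g 1 \<otimes> ?Z)"
    using mem X_closed by (intro m_assoc m_closed)
  finally have "?Z \<otimes> g 1 = g 1 \<otimes> ?Z"
    using unit mem X_closed by simp
  then have "g 1 \<otimes> (X \<otimes> g 1 \<otimes> X \<otimes> g 1) = g 1 \<otimes> ?Z"
    using mem X_closed by (simp add: m_assoc)
  then show ?thesis
    using unit mem X_closed by simp
qed

end

end

section \<open>Algebras over Laurent polynomials\<close>

lemma int_adjoin_inverse_subring:
  assumes "r \<ge> 1"
  shows "coeff_subring (int_adjoin_inverse r)"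
proof
  show "1 \<in> int_adjoin_inverse r"
    unfolding int_adjoin_inverse_def by (rule CollectI, intro exI[of _ 1] exI[of _ 0]) simp
next
  fix x y assume "x \<in> int_adjoin_inverse r" "y \<in> int_adjoin_inverse r"
  then obtain a b :: int and k l :: nat where
    xy: "x = of_int a / of_nat r ^ k" "y = of_int b / of_nat r ^ l"
    by (auto simp: int_adjoin_inverse_def)
  have "x - y = of_int (a * int r ^ l - b * int r ^ k) / of_nat r ^ (k + l)"
    "x * y = of_int (a * b) / of_nat r ^ (k + l)"
    unfolding xy using assms by (simp_all add: field_simps power_add)
  then show "x - y \<in> int_adjoin_inverse r" "x * y \<in> int_adjoin_inverse r"
    unfolding int_adjoin_inverse_def by blast+
qed

text \<open>A coefficient of a product is a finite sum of products of coefficients, so closure is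
  inherited from \<open>int_adjoin_inverse r\<close>.\<close>

lemma laurent_ring_subring:
  assumes "r \<ge> 1"
  shows "coeff_subring (laurent_ring r)"
proof -
  interpret C: coeff_subring "int_adjoin_inverse r"
    using assms by (rule int_adjoin_inverse_subring)
  have sum: "sum h S \<in> int_adjoin_inverse r" if "\<And>s. s \<in> S \<Longrightarrow> h s \<in> int_adjoin_inverse r"
    for h :: "'c \<Rightarrow> rat" and S
    using that by (induction S rule: infinite_finite_induct) (simp_all add: C.zero_mem C.add_mem)
  show ?thesis
  proof
    show "1 \<in> laurent_ring r"
      by (simp add: laurent_ring_def lookup_one when_def C.one_mem C.zero_mem)
  next
    fix f g assume fg: "f \<in> laurent_ring r" "g \<in> laurent_ring r"
    then show "f - g \<in> laurent_ring r"
      by (simp add: laurent_ring_def lookup_minus C.diff_mem)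
    have expand: "h = (\<Sum>k\<in>Poly_Mapping.keys h. Poly_Mapping.single k (Poly_Mapping.lookup h k))"
      for h :: laurent
      by (rule poly_mapping_eqI)
        (auto simp: lookup_sum lookup_single when_def not_in_keys_iff_lookup_eq_zero)
    have "f * g = (\<Sum>k\<in>Poly_Mapping.keys f. \<Sum>l\<in>Poly_Mapping.keys g.
        Poly_Mapping.single (k + l) (Poly_Mapping.lookup f k * Poly_Mapping.lookup g l))"
      by (subst expand[of f], subst expand[of g]) (simp add: sum_product mult_single)
    then show "f * g \<in> laurent_ring r"
      using fg by (auto simp: laurent_ring_def lookup_sum lookup_single when_def C.zero_mem
          intro!: sum C.mult_mem)
  qed
qed

locale laurent_coeffs =
  fixes r :: nat
  assumes r_pos: "r \<ge> 1"
begin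

sublocale coeff_subring "laurent_ring r"
  using r_pos by (rule laurent_ring_subring)

lemma recip_mem: "recip r \<in> laurent_ring r"
proof -
  interpret C: coeff_subring "int_adjoin_inverse r"
    using r_pos by (rule int_adjoin_inverse_subring)
  have "1 / of_nat r \<in> int_adjoin_inverse r"
    unfolding int_adjoin_inverse_def by (rule CollectI, intro exI[of _ 1] exI[of _ 1]) simp
  then show ?thesis
    by (simp add: laurent_ring_def recip_def lookup_single when_def C.zero_mem)
qed

lemma qdiff_mem: "qvar - qvar_inv \<in> laurent_ring r"
proof -
  interpret C: coeff_subring "int_adjoin_inverse r"
    using r_pos by (rule int_adjoin_inverse_subring)
  show ?thesis
    by (rule diff_mem)
      (simp_all add: laurent_ring_def qvar_def qvar_inv_def lookup_single when_def C.zero_mem C.one_mem)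
qed

lemma e_idem_in_free_algebra:
  assumes "a \<in> carrier (free_algebra (laurent_ring r) G)" "b \<in> carrier (free_algebra (laurent_ring r) G)"
  shows "e_idem r a b \<in> carrier (free_algebra (laurent_ring r) G)"
  unfolding e_idem_def
  by (intro mult_in_free_algebra scalar_in_free_algebra recip_mem sum_in_free_algebra
      power_in_free_algebra assms)

lemmas free_mem_simps = gen_in_free_algebra mult_in_free_algebra add_in_free_algebra one_in_free_algebra
  power_in_free_algebra scalar_in_free_algebra qdiff_mem

end

text \<open>The value of \<open>e_idem\<close> at elements of an algebra. The exponent
  \<open>r - s\<close> again stands for \<open>-s\<close>, which is justified when the
  \<open>r\<close>-th power of \<open>b\<close> is 1.\<close>

definition e_elem :: "(laurent, 'b) module \<Rightarrow> nat \<Rightarrow> 'b \<Rightarrow> 'b \<Rightarrow> 'b" where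
  "e_elem B r a b = recip r \<odot>\<^bsub>B\<^esub> (\<Oplus>\<^bsub>B\<^esub>s\<in>{..<r}. a [^]\<^bsub>B\<^esub> s \<otimes>\<^bsub>B\<^esub> b [^]\<^bsub>B\<^esub> (r - s))"

locale laurent_algebra = laurent_coeffs r + assoc_algebra "laurent_ring r" B for r and B (structure)
begin

lemma e_elem_closed [simp]: "a \<in> carrier B \<Longrightarrow> b \<in> carrier B \<Longrightarrow> e_elem B r a b \<in> carrier B"
  by (auto simp: e_elem_def recip_mem intro!: smult_closed finsum_closed)

text \<open>Conjugation acts summand by summand. It is applied to \<open>g_i\<close>, which
  interchanges the two arguments, and to \<open>rho\<close>, which shifts them.\<close>

lemma intertwine_e_elem:
  assumes "c \<otimes> a = a' \<otimes> c" "c \<otimes> b = b' \<otimes> c"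
    and mem: "c \<in> carrier B" "a \<in> carrier B" "b \<in> carrier B" "a' \<in> carrier B" "b' \<in> carrier B"
  shows "c \<otimes> e_elem B r a b = e_elem B r a' b' \<otimes> c"
proof -
  have "c \<otimes> (\<Oplus>s\<in>{..<r}. a [^] s \<otimes> b [^] (r - s)) = (\<Oplus>s\<in>{..<r}. c \<otimes> (a [^] s \<otimes> b [^] (r - s)))"
    using mem by (intro finsum_rdistr) auto
  also have "\<dots> = (\<Oplus>s\<in>{..<r}. (a' [^] s \<otimes> b' [^] (r - s)) \<otimes> c)"
    using assms by (intro finsum_cong' intertwine_mult intertwine_pow) auto
  also have "\<dots> = (\<Oplus>s\<in>{..<r}. a' [^] s \<otimes> b' [^] (r - s)) \<otimes> c"
    using mem by (intro finsum_ldistr[symmetric]) auto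
  finally show ?thesis
    using mem by (simp add: e_elem_def smult_mult_l smult_mult_r recip_mem)
qed

text \<open>Negating the summation index modulo \<open>r\<close> exchanges the roles of
  \<open>a\<close> and \<open>b\<close>. This symmetry is what makes \<open>e_i\<close> commute with
  \<open>g_i\<close>.\<close>

lemma e_elem_swap:
  assumes comm: "a \<otimes> b = b \<otimes> a" and pow: "a [^] r = \<one>" "b [^] r = \<one>"
    and mem: "a \<in> carrier B" "b \<in> carrier B"
  shows "e_elem B r a b = e_elem B r b a"
proof -
  let ?f = "\<lambda>s. a [^] s \<otimes> b [^] (r - s)"
  define h where "h s = (if s = 0 then 0 else r - s)" for s \<comment> \<open>\<open>s \<mapsto> - s\<close> modulo \<open>r\<close>\<close>
  have inj: "inj_on h {..<r}" by (auto simp: inj_on_def h_def split: if_splits)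
  have "h ` {..<r} = {..<r}"
    by (rule endo_inj_surj) (use inj r_pos in \<open>auto simp: h_def\<close>)
  then have "(\<Oplus>s\<in>{..<r}. ?f s) = (\<Oplus>s\<in>{..<r}. ?f (h s))"
    using finsum_reindex[of ?f h "{..<r}"] inj mem by auto
  also have "\<dots> = (\<Oplus>s\<in>{..<r}. b [^] s \<otimes> a [^] (r - s))"
  proof (rule finsum_cong')
    fix s assume s: "s \<in> {..<r}"
    have "a [^] (r - s) \<otimes> b [^] s = b [^] s \<otimes> a [^] (r - s)"
      using comm mem by (intro intertwine_pow intertwine_pow[symmetric]) auto
    \<comment> \<open>At \<open>s = 0\<close> both sides are 1, because the \<open>r\<close>-th
      powers of \<open>a\<close> and \<open>b\<close> are 1.\<close>
    then show "?f (h s) = b [^] s \<otimes> a [^] (r - s)"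
      using s by (auto simp: h_def pow)
  qed (use mem in auto)
  finally show ?thesis by (simp add: e_elem_def)
qed

text \<open>The relation reads \<open>(g - c e) g = 1\<close>; as \<open>e\<close> commutes with
  \<open>g\<close>, the element \<open>g - c e\<close> is a right inverse too.\<close>

lemma unit_if_quadratic:
  assumes quad: "g \<otimes> g = \<one> \<oplus> c \<odot> (e \<otimes> g)" and comm: "g \<otimes> e = e \<otimes> g"
    and mem: "c \<in> laurent_ring r" "e \<in> carrier B" "g \<in> carrier B"
  shows "g \<in> Units B"
proof -
  have "g \<otimes> (g \<ominus> c \<odot> e) = g \<otimes> g \<ominus> c \<odot> (e \<otimes> g)" "(g \<ominus> c \<odot> e) \<otimes> g = g \<otimes> g \<ominus> c \<odot> (e \<otimes> g)"
    using mem comm by (simp_all add: a_minus_def r_distr l_distr r_minus l_minus smult_mult_l smult_mult_r)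
  moreover have "g \<otimes> g \<ominus> c \<odot> (e \<otimes> g) = \<one>"
    using mem by (simp add: quad a_minus_def a_assoc r_neg)
  moreover have "g \<ominus> c \<odot> e \<in> carrier B"
    using mem by simp
  ultimately show ?thesis
    using mem by (auto simp: Units_def)
qed

context
  fixes G :: "'g set" and \<phi> :: "'g \<Rightarrow> 'a"
  assumes \<phi>: "\<phi> \<in> G \<rightarrow> carrier B"
begin

lemma free_eval_power:
  "f \<in> carrier (free_algebra (laurent_ring r) G) \<Longrightarrow>
    free_eval B \<phi> (f ^ k) = free_eval B \<phi> f [^] k"
  by (induction k)
    (simp_all del: power_Suc add: power_Suc2 free_eval_one[OF \<phi>] free_eval_mult[OF \<phi>]
      power_in_free_algebra free_eval_closed[OF \<phi>])

lemma free_eval_sum: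
  assumes "finite S" "\<And>s. s \<in> S \<Longrightarrow> f s \<in> carrier (free_algebra (laurent_ring r) G)"
  shows "free_eval B \<phi> (sum f S) = (\<Oplus>s\<in>S. free_eval B \<phi> (f s))"
  using assms
proof (induction S rule: finite_induct)
  case empty
  then show ?case by (simp add: free_eval_zero[OF \<phi>])
next
  case (insert s S)
  then have "(\<lambda>s. free_eval B \<phi> (f s)) \<in> S \<rightarrow> carrier B" "free_eval B \<phi> (f s) \<in> carrier B"
    using free_eval_closed[OF \<phi>] by auto
  with insert show ?case
    by (simp add: free_eval_add[OF \<phi>] sum_in_free_algebra)
qed

lemma free_eval_e_idem:
  assumes "a \<in> carrier (free_algebra (laurent_ring r) G)" "b \<in> carrier (free_algebra (laurent_ring r) G)"
  shows "free_eval B \<phi> (e_idem r a b) = e_elem B r (free_eval B \<phi> a) (free_eval B \<phi> b)"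
proof -
  let ?f = "\<lambda>s. a ^ s * b ^ (r - s)"
  have mem: "?f s \<in> carrier (free_algebra (laurent_ring r) G)" for s
    by (intro mult_in_free_algebra power_in_free_algebra assms)
  have "free_eval B \<phi> (sum ?f {..<r}) = (\<Oplus>s\<in>{..<r}. free_eval B \<phi> a [^] s \<otimes> free_eval B \<phi> b [^] (r - s))"
    using assms mem
    by (subst free_eval_sum) (auto simp: free_eval_mult[OF \<phi>] free_eval_power power_in_free_algebra
        free_eval_closed[OF \<phi>] intro!: finsum_cong')
  moreover have "sum ?f {..<r} \<in> carrier (free_algebra (laurent_ring r) G)"
    by (intro sum_in_free_algebra mem)
  ultimately show ?thesis
    using free_eval_closed[OF \<phi>] assms
    by (simp add: e_idem_def e_elem_def free_eval_mult[OF \<phi>] scalar_in_free_algebra recip_mem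
        free_eval_scalar[OF \<phi>] smult_mult_l)
qed

end

end

text \<open>The relations of the finite Yokonuma-Hecke algebra, which both presentations
  contain.\<close>

locale torus_hecke = laurent_algebra r B + braid_torus B n g t
  for r and B (structure) and n :: nat and g t :: "nat \<Rightarrow> 'a" +
  assumes t_comm: "i \<in> {1..n} \<Longrightarrow> j \<in> {1..n} \<Longrightarrow> t i \<otimes> t j = t j \<otimes> t i"
    and t_pow: "i \<in> {1..n} \<Longrightarrow> t i [^] r = \<one>"
    and g_quad: "i \<in> {1..<n} \<Longrightarrow>
      g i \<otimes> g i = \<one> \<oplus> (qvar - qvar_inv) \<odot> (e_elem B r (t i) (t (i + 1)) \<otimes> g i)"
begin

text \<open>Moving \<open>g_i\<close> across \<open>e_i\<close> swaps the arguments
  \<open>t_i\<close> and \<open>t_(i+1)\<close>, and the symmetry of \<open>e_elem\<close> undoes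
  the swap.\<close>

lemma g_Units:
  assumes i: "i \<in> {1..<n}"
  shows "g i \<in> Units B"
proof (rule unit_if_quadratic[OF g_quad[OF i]])
  have t: "t i \<in> carrier B" "t (i + 1) \<in> carrier B" using i by (auto intro!: t_closed)
  have "g i \<otimes> e_elem B r (t i) (t (i + 1)) = e_elem B r (t (i + 1)) (t i) \<otimes> g i"
    using g_t[OF i, of i] g_t[OF i, of "i + 1"] i g_closed[OF i] t by (intro intertwine_e_elem) auto
  then show "g i \<otimes> e_elem B r (t i) (t (i + 1)) = e_elem B r (t i) (t (i + 1)) \<otimes> g i"
    using e_elem_swap[of "t i" "t (i + 1)"] t_comm[of i "i + 1"] t_pow[of i] t_pow[of "i + 1"] t i by simp
qed (use i in \<open>auto intro!: qdiff_mem e_elem_closed t_closed g_closed\<close>)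

lemma gprod_Units: "set xs \<subseteq> {1..<n} \<Longrightarrow> gprod xs \<in> Units B"
  unfolding gprod_def by (rule list_prod_Units) (use g_Units in fastforce)

lemma inv_gprod_rev:
  "set xs \<subseteq> {1..<n} \<Longrightarrow> inv gprod (rev xs) = list_prod B (map (\<lambda>i. inv g i) xs)"
  unfolding gprod_def by (rule inv_list_prod_rev) (use g_Units in auto)

end


section \<open>Representations of the two presentations\<close>

lemma ygens_iff [simp]:
  "YT j \<in> ygens n \<longleftrightarrow> j \<in> {1..n}" "YG i \<in> ygens n \<longleftrightarrow> i \<in> {1..<n}"
  "YX \<in> ygens n" "YXinv \<in> ygens n"
  by (auto simp: ygens_def)

lemma hgens_iff [simp]:
  "HT j \<in> hgens n \<longleftrightarrow> j \<in> {1..n}" "HS i \<in> hgens n \<longleftrightarrow> i \<in> refl_indices n"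
  "HRho \<in> hgens n" "HRhoinv \<in> hgens n"
  by (auto simp: hgens_def)

lemma transpose_mem: "i \<in> {1..<n :: nat} \<Longrightarrow> j \<in> {1..n} \<Longrightarrow> Transposition.transpose i (i + 1) j \<in> {1..n}"
  by (auto simp: Transposition.transpose_def)

lemma refl_indices_iff: "i \<in> refl_indices n \<longleftrightarrow> n \<noteq> 1 \<and> i < n"
  by (auto simp: refl_indices_def)

text \<open>Elements of an arbitrary algebra satisfying the relations. Two instances matter for this
  locale and for its companion \<open>hecke_rep\<close>: the presented algebra with its own
  generators, and the other presented algebra with suitable elements, which gives the
  homomorphism.\<close>

locale yokonuma_rep = laurent_algebra r B for r and B (structure) +
  fixes n :: nat and \<phi> :: "ygen \<Rightarrow> 'a"
  assumes n_pos: "n \<ge> 1"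
    and \<phi>: "\<phi> \<in> ygens n \<rightarrow> carrier B"
    and rel: "yrel r n u v \<Longrightarrow> free_eval B \<phi> u = free_eval B \<phi> v"

locale hecke_rep = laurent_algebra r B for r and B (structure) +
  fixes n :: nat and \<phi> :: "hgen \<Rightarrow> 'a"
  assumes n_pos: "n \<ge> 1"
    and \<phi>: "\<phi> \<in> hgens n \<rightarrow> carrier B"
    and rel: "hrel r n u v \<Longrightarrow> free_eval B \<phi> u = free_eval B \<phi> v"

context laurent_algebra
begin

context
  fixes G :: "'g set" and \<phi> :: "'g \<Rightarrow> 'a"
  assumes \<phi>: "\<phi> \<in> G \<rightarrow> carrier B"
begin

lemmas free_eval_simps = free_eval_mult[OF \<phi>] free_eval_add[OF \<phi>] free_eval_gen[OF \<phi>] free_eval_one[OF \<phi>]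
  free_eval_scalar[OF \<phi>] free_eval_power[OF \<phi>] free_mem_simps

lemma free_eval_gen_square: "z \<in> G \<Longrightarrow> free_eval B \<phi> (gen z ^ 2) = \<phi> z \<otimes> \<phi> z"
  by (simp add: power2_eq_square free_eval_simps)

lemma free_eval_quadratic:
  assumes "x \<in> G" "y \<in> G" "z \<in> G"
  shows "free_eval B \<phi> (1 + scalar (qvar - qvar_inv) * e_idem r (gen x) (gen y) * gen z) =
      \<one> \<oplus> (qvar - qvar_inv) \<odot> (e_elem B r (\<phi> x) (\<phi> y) \<otimes> \<phi> z)"
proof -
  have c: "\<phi> x \<in> carrier B" "\<phi> y \<in> carrier B" "\<phi> z \<in> carrier B" using assms \<phi> by auto
  have e: "e_idem r (gen x) (gen y) \<in> carrier (free_algebra (laurent_ring r) G)"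
    using assms by (intro e_idem_in_free_algebra gen_in_free_algebra)
  show "free_eval B \<phi> (1 + scalar (qvar - qvar_inv) * e_idem r (gen x) (gen y) * gen z) =
      \<one> \<oplus> (qvar - qvar_inv) \<odot> (e_elem B r (\<phi> x) (\<phi> y) \<otimes> \<phi> z)"
    using assms c e
    by (simp add: free_eval_simps free_eval_e_idem[OF \<phi>] smult_mult_l)
qed

end

end

section \<open>The Bernstein relations as equations in an algebra\<close>

context yokonuma_rep
begin

lemma
  shows t_closed: "j \<in> {1..n} \<Longrightarrow> \<phi> (YT j) \<in> carrier B"
    and g_closed: "i \<in> {1..<n} \<Longrightarrow> \<phi> (YG i) \<in> carrier B"
    and X_closed: "\<phi> YX \<in> carrier B" and Xinv_closed: "\<phi> YXinv \<in> carrier B"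
  using \<phi> by auto

lemma g_comm:
  "i \<in> {1..<n} \<Longrightarrow> j \<in> {1..<n} \<Longrightarrow> \<bar>int i - int j\<bar> \<ge> 2 \<Longrightarrow>
    \<phi> (YG i) \<otimes> \<phi> (YG j) = \<phi> (YG j) \<otimes> \<phi> (YG i)"
  using rel[OF yrel.g_comm[of i n j r]] by (simp add: free_eval_simps[OF \<phi>])

lemma g_braid:
  "1 \<le> i \<Longrightarrow> i + 1 < n \<Longrightarrow>
    \<phi> (YG i) \<otimes> \<phi> (YG (i + 1)) \<otimes> \<phi> (YG i) = \<phi> (YG (i + 1)) \<otimes> \<phi> (YG i) \<otimes> \<phi> (YG (i + 1))"
  using rel[OF yrel.g_braid[of i n r]] by (simp add: free_eval_simps[OF \<phi>])

lemma t_comm: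
  "i \<in> {1..n} \<Longrightarrow> j \<in> {1..n} \<Longrightarrow> \<phi> (YT i) \<otimes> \<phi> (YT j) = \<phi> (YT j) \<otimes> \<phi> (YT i)"
  using rel[OF yrel.t_comm[of i n j r]] by (simp add: free_eval_simps[OF \<phi>])

lemma g_t:
  "i \<in> {1..<n} \<Longrightarrow> j \<in> {1..n} \<Longrightarrow>
    \<phi> (YG i) \<otimes> \<phi> (YT j) = \<phi> (YT (Transposition.transpose i (i + 1) j)) \<otimes> \<phi> (YG i)"
  using rel[OF yrel.g_t[of i n j r]] transpose_mem[of i n j] by (simp add: free_eval_simps[OF \<phi>])

lemma t_pow: "i \<in> {1..n} \<Longrightarrow> \<phi> (YT i) [^] r = \<one>"
  using rel[OF yrel.t_pow[of i n r]] by (simp add: free_eval_simps[OF \<phi>])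

lemma g_quad:
  "i \<in> {1..<n} \<Longrightarrow> \<phi> (YG i) \<otimes> \<phi> (YG i) =
    \<one> \<oplus> (qvar - qvar_inv) \<odot> (e_elem B r (\<phi> (YT i)) (\<phi> (YT (i + 1))) \<otimes> \<phi> (YG i))"
  using rel[OF yrel.g_quad[of i n r]] by (simp add: free_eval_gen_square[OF \<phi>] free_eval_quadratic[OF \<phi>])

lemma X_Xinv: "\<phi> YX \<otimes> \<phi> YXinv = \<one>" and Xinv_X: "\<phi> YXinv \<otimes> \<phi> YX = \<one>"
  using rel[OF yrel.X_Xinv] rel[OF yrel.Xinv_X] by (simp_all add: free_eval_simps[OF \<phi>])

lemma X_braid:
  "1 < n \<Longrightarrow> \<phi> (YG 1) \<otimes> \<phi> YX \<otimes> \<phi> (YG 1) \<otimes> \<phi> YX = \<phi> YX \<otimes> \<phi> (YG 1) \<otimes> \<phi> YX \<otimes> \<phi> (YG 1)"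
  using rel[OF yrel.g_X_braid[of n r]] by (simp add: free_eval_simps[OF \<phi>])

lemma g_X: "i \<in> {2..<n} \<Longrightarrow> \<phi> (YG i) \<otimes> \<phi> YX = \<phi> YX \<otimes> \<phi> (YG i)"
  using rel[OF yrel.g_X[of i n r]] by (simp add: free_eval_simps[OF \<phi>])

lemma t_X: "j \<in> {1..n} \<Longrightarrow> \<phi> (YT j) \<otimes> \<phi> YX = \<phi> YX \<otimes> \<phi> (YT j)"
  using rel[OF yrel.t_X[of j n r]] by (simp add: free_eval_simps[OF \<phi>])

sublocale torus_hecke r B n "\<lambda>i. \<phi> (YG i)" "\<lambda>j. \<phi> (YT j)"
  by unfold_locales (rule g_closed t_closed g_comm g_braid g_t t_comm t_pow g_quad; assumption)+

end

section \<open>The Iwahori-Matsumoto relations as equations in an algebra\<close>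

context hecke_rep
begin

lemma t_index_mem [simp]: "j \<le> n \<Longrightarrow> t_index n j \<in> hgens n"
  using n_pos by (auto simp: t_index_def)

lemma
  shows t_closed: "j \<in> {1..n} \<Longrightarrow> \<phi> (HT j) \<in> carrier B"
    and s_closed: "i \<in> refl_indices n \<Longrightarrow> \<phi> (HS i) \<in> carrier B"
    and rho_closed: "\<phi> HRho \<in> carrier B" and rhoinv_closed: "\<phi> HRhoinv \<in> carrier B"
  using \<phi> by auto

lemma t_comm:
  "i \<in> {1..n} \<Longrightarrow> j \<in> {1..n} \<Longrightarrow> \<phi> (HT i) \<otimes> \<phi> (HT j) = \<phi> (HT j) \<otimes> \<phi> (HT i)"
  using rel[OF hrel.t_comm[of i n j r]] by (simp add: free_eval_simps[OF \<phi>])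

lemma t_pow: "i \<in> {1..n} \<Longrightarrow> \<phi> (HT i) [^] r = \<one>"
  using rel[OF hrel.t_pow[of i n r]] by (simp add: free_eval_simps[OF \<phi>])

lemma s_t:
  "i \<in> {1..<n} \<Longrightarrow> j \<in> {1..n} \<Longrightarrow>
    \<phi> (HS i) \<otimes> \<phi> (HT j) = \<phi> (HT (Transposition.transpose i (i + 1) j)) \<otimes> \<phi> (HS i)"
  using rel[OF hrel.T_t[of i n j r]] transpose_mem[of i n j]
  by (simp add: free_eval_simps[OF \<phi>] refl_indices_iff)

lemma rho_t:
  assumes "j \<in> {1..n}"
  shows "\<phi> HRho \<otimes> \<phi> (HT j) = \<phi> (t_index n (j - 1)) \<otimes> \<phi> HRho"
proof -
  have "t_index n (j - 1) \<in> hgens n" using assms by (intro t_index_mem) auto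
  then show ?thesis
    using rel[OF hrel.rho_t[OF assms]] assms by (simp add: free_eval_simps[OF \<phi>])
qed

lemma rho_s: "i \<in> refl_indices n \<Longrightarrow> \<phi> HRho \<otimes> \<phi> (HS i) = \<phi> (HS ((i + (n - 1)) mod n)) \<otimes> \<phi> HRho"
  using rel[OF hrel.rho_T[of i n r]] by (simp add: free_eval_simps[OF \<phi>] refl_indices_iff)

text \<open>Away from index 0, distance at least 2 excludes congruence to 1 or -1 modulo
  \<open>n\<close>: the numbers \<open>i - j - 1\<close> and \<open>i - j + 1\<close> are nonzero
  and smaller than \<open>n\<close> in absolute value.\<close>

lemma s_comm:
  assumes "i \<in> {1..<n}" "j \<in> {1..<n}" "\<bar>int i - int j\<bar> \<ge> 2"
  shows "\<phi> (HS i) \<otimes> \<phi> (HS j) = \<phi> (HS j) \<otimes> \<phi> (HS i)"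
proof -
  have "\<not> int n dvd x" if "x \<noteq> 0" "\<bar>x\<bar> < int n" for x
    using that zdvd_imp_le[of "int n" "\<bar>x\<bar>"] by auto
  then have "\<not> int n dvd (int i - int j - 1)" "\<not> int n dvd (int i - int j + 1)"
    using assms by auto
  then show ?thesis
    using rel[OF hrel.T_comm[of i n j r]] assms
    by (simp add: free_eval_simps[OF \<phi>] refl_indices_iff cong_iff_dvd_diff)
qed

lemma s_braid:
  "1 \<le> i \<Longrightarrow> i + 1 < n \<Longrightarrow>
    \<phi> (HS i) \<otimes> \<phi> (HS (i + 1)) \<otimes> \<phi> (HS i) = \<phi> (HS (i + 1)) \<otimes> \<phi> (HS i) \<otimes> \<phi> (HS (i + 1))"
  using rel[OF hrel.T_braid[of i n r]] by (simp add: free_eval_simps[OF \<phi>] refl_indices_iff)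

lemma s_quad:
  "i \<in> {1..<n} \<Longrightarrow> \<phi> (HS i) \<otimes> \<phi> (HS i) =
    \<one> \<oplus> (qvar - qvar_inv) \<odot> (e_elem B r (\<phi> (HT i)) (\<phi> (HT (i + 1))) \<otimes> \<phi> (HS i))"
  using rel[OF hrel.T_quad[of i n r]]
  by (simp add: free_eval_gen_square[OF \<phi>] free_eval_quadratic[OF \<phi>] refl_indices_iff t_index_def)

lemma rho_rhoinv: "\<phi> HRho \<otimes> \<phi> HRhoinv = \<one>" and rhoinv_rho: "\<phi> HRhoinv \<otimes> \<phi> HRho = \<one>"
  using rel[OF hrel.rho_rhoinv] rel[OF hrel.rhoinv_rho] by (simp_all add: free_eval_simps[OF \<phi>])

sublocale torus_hecke r B n "\<lambda>i. \<phi> (HS i)" "\<lambda>j. \<phi> (HT j)"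
proof unfold_locales
  show "i \<in> {1..<n} \<Longrightarrow> \<phi> (HS i) \<in> carrier B" for i
    by (rule s_closed) (auto simp: refl_indices_iff)
qed (rule t_closed s_comm s_braid s_t t_comm t_pow s_quad; assumption)+

end


section \<open>The map on generators from the Iwahori--Matsumoto form\<close>

context yokonuma_rep
begin

definition rho :: 'a where
  "rho = gprod (rev [1..<n]) \<otimes> \<phi> YX"

text \<open>\<open>T_0\<close> goes to a conjugate of \<open>g_1\<close>, so that rotation from
  index 1 to index 0 holds by construction; \<open>hmap_zero\<close> recovers the product in the
  theorem. The branch for index 0 concerns \<open>n >= 2\<close>, since \<open>HS 0\<close> is not a
  generator for \<open>n = 1\<close>.\<close>

definition hmap :: "hgen \<Rightarrow> 'a" where
  "hmap x = (case x of HT j \<Rightarrow> \<phi> (YT j)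
    | HS i \<Rightarrow> if i = 0 then rho \<otimes> \<phi> (YG 1) \<otimes> inv rho else \<phi> (YG i)
    | HRho \<Rightarrow> rho | HRhoinv \<Rightarrow> inv rho)"

lemma hmap_simps:
  "hmap (HT j) = \<phi> (YT j)" "hmap (HS 0) = rho \<otimes> \<phi> (YG 1) \<otimes> inv rho"
  "i \<noteq> 0 \<Longrightarrow> hmap (HS i) = \<phi> (YG i)" "hmap HRho = rho" "hmap HRhoinv = inv rho"
  by (simp_all add: hmap_def)

lemma X_Units: "\<phi> YX \<in> Units B"
  using X_closed Xinv_closed X_Xinv Xinv_X by (auto simp: Units_def)

lemma inv_X: "inv (\<phi> YX) = \<phi> YXinv"
  using X_closed Xinv_closed X_Xinv Xinv_X by (intro inv_unique'[symmetric]) auto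

lemma rho_Units: "rho \<in> Units B"
  unfolding rho_def by (intro Units_m_closed gprod_Units X_Units) auto

lemma inv_rho: "inv rho = \<phi> YXinv \<otimes> list_prod B (map (\<lambda>i. inv \<phi> (YG i)) [1..<n])"
  unfolding rho_def by (subst inv_mult_Units)
    (auto simp: inv_X inv_gprod_rev X_Units intro!: gprod_Units)

lemma hmap_closed: "hmap \<in> hgens n \<rightarrow> carrier B"
proof
  fix x assume x: "x \<in> hgens n"
  have rho: "rho \<in> carrier B" "inv rho \<in> carrier B" using rho_Units by auto
  show "hmap x \<in> carrier B"
  proof (cases x)
    case (HS i)
    then have "n \<ge> 2" "i < n" using x n_pos by (auto simp: refl_indices_iff)
    then show ?thesis using rho HS by (auto simp: hmap_def intro!: m_closed g_closed)
  qed (use x rho in \<open>auto simp: hmap_def intro!: t_closed\<close>)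
qed

text \<open>\<open>X_1\<close> commutes with every \<open>t_j\<close>, so \<open>rho\<close> acts on
  them as \<open>D\<close> does, by the cycle taking 1 to \<open>n\<close>; hence the convention for
  index 0.\<close>

lemma rho_hmap_t:
  assumes j: "j \<in> {1..n}"
  shows "rho \<otimes> hmap (HT j) = hmap (t_index n (j - 1)) \<otimes> rho"
proof -
  let ?D = "gprod (rev [1..<n])" and ?k = "if j = 1 then n else j - 1"
  have D: "?D \<otimes> \<phi> (YT j) = \<phi> (YT ?k) \<otimes> ?D"
    using gprod_descending_t[of n j] j n_pos by auto
  have "?k \<in> {1..n}" using j by auto
  then have mem: "?D \<in> carrier B" "\<phi> (YT j) \<in> carrier B" "\<phi> (YT ?k) \<in> carrier B"
    using j t_closed by (auto intro!: gprod_closed)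
  have "rho \<otimes> \<phi> (YT j) = ?D \<otimes> (\<phi> (YT j) \<otimes> \<phi> YX)"
    using mem X_closed t_X[OF j] by (simp add: rho_def m_assoc)
  also have "\<dots> = \<phi> (YT ?k) \<otimes> rho"
    using mem X_closed D by (metis m_assoc rho_def)
  finally show ?thesis
    using j by (auto simp: hmap_def t_index_def)
qed

text \<open>Each case has its own source: for \<open>i >= 2\<close> the lowering of indices by
  \<open>D\<close>, for \<open>i = 1\<close> the choice of the image of \<open>T_0\<close>, and for
  \<open>i = 0\<close> the equation for \<open>rho^2\<close> multiplied by \<open>rho^-1\<close> on
  the right.\<close>

lemma rho_hmap_s:
  assumes i: "i \<in> refl_indices n"
  shows "rho \<otimes> hmap (HS i) = hmap (HS ((i + (n - 1)) mod n)) \<otimes> rho"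
proof -
  have n: "n \<ge> 2" "i < n" using i n_pos by (auto simp: refl_indices_iff)
  have mem: "rho \<in> carrier B" "inv rho \<in> carrier B" "\<phi> (YG 1) \<in> carrier B" "\<phi> (YG (n - 1)) \<in> carrier B"
    using rho_Units n by (auto intro!: g_closed)
  consider "i = 0" | "i = 1" | "2 \<le> i" by linarith
  then show ?thesis
  proof cases
    assume "i = 0"
    have "rho \<otimes> (rho \<otimes> \<phi> (YG 1) \<otimes> inv rho) = (rho \<otimes> rho \<otimes> \<phi> (YG 1)) \<otimes> inv rho"
      using mem by (simp add: m_assoc)
    also have "rho \<otimes> rho \<otimes> \<phi> (YG 1) = \<phi> (YG (n - 1)) \<otimes> (rho \<otimes> rho)"
      unfolding rho_def using n X_closed g_X X_braid by (intro rho_squared_g) auto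
    also have "\<phi> (YG (n - 1)) \<otimes> (rho \<otimes> rho) \<otimes> inv rho = \<phi> (YG (n - 1)) \<otimes> rho"
      using mem rho_Units by (simp add: m_assoc)
    finally show ?thesis
      using \<open>i = 0\<close> n by (simp add: hmap_def)
  next
    assume "i = 1"
    have "rho \<otimes> \<phi> (YG 1) \<otimes> inv rho \<otimes> rho = rho \<otimes> \<phi> (YG 1)"
      using mem rho_Units by (simp add: m_assoc)
    then show ?thesis
      using \<open>i = 1\<close> n by (simp add: hmap_def)
  next
    assume "2 \<le> i"
    then have "rho \<otimes> \<phi> (YG i) = \<phi> (YG (i - 1)) \<otimes> rho"
      unfolding rho_def using n X_closed g_X by (intro rho_g) auto
    moreover have "(i + (n - 1)) mod n = i - 1"
      using n \<open>2 \<le> i\<close> by (simp add: mod_if)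
    ultimately show ?thesis
      using \<open>2 \<le> i\<close> by (simp add: hmap_def)
  qed
qed

lemma hmap_s_closed: "i \<in> refl_indices n \<Longrightarrow> hmap (HS i) \<in> carrier B"
  using hmap_closed by auto

lemma hmap_t_index_closed: "j \<le> n \<Longrightarrow> hmap (t_index n j) \<in> carrier B"
  using hmap_closed n_pos by (auto simp: t_index_def)

text \<open>This is the commutation of the indices 1 and \<open>j + 1\<close>, conjugated by
  \<open>rho\<close>. The upper bound on \<open>j\<close> leaves out the neighbour
  \<open>n - 1\<close> of 0 and keeps \<open>j + 1\<close> in the finite range.\<close>

lemma hmap_comm_zero:
  assumes j: "2 \<le> j" "j + 2 \<le> n"
  shows "hmap (HS 0) \<otimes> hmap (HS j) = hmap (HS j) \<otimes> hmap (HS 0)"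
proof (rule intertwine_eq[where c = rho])
  have mem: "0 \<in> refl_indices n" "1 \<in> refl_indices n" "j \<in> refl_indices n" "j + 1 \<in> refl_indices n"
    using j by (auto simp: refl_indices_iff)
  show "hmap (HS 1) \<otimes> hmap (HS (j + 1)) = hmap (HS (j + 1)) \<otimes> hmap (HS 1)"
    using g_comm[of 1 "j + 1"] j by (simp add: hmap_def)
  have "(j + 1 + (n - 1)) mod n = j" "(1 + (n - 1)) mod n = 0" using j by (simp_all add: mod_if)
  then have "rho \<otimes> hmap (HS (j + 1)) = hmap (HS j) \<otimes> rho" "rho \<otimes> hmap (HS 1) = hmap (HS 0) \<otimes> rho"
    using rho_hmap_s mem by metis+
  then show "rho \<otimes> (hmap (HS 1) \<otimes> hmap (HS (j + 1))) = hmap (HS 0) \<otimes> hmap (HS j) \<otimes> rho"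
    "rho \<otimes> (hmap (HS (j + 1)) \<otimes> hmap (HS 1)) = hmap (HS j) \<otimes> hmap (HS 0) \<otimes> rho"
    using mem rho_Units by (auto intro!: intertwine_mult hmap_s_closed)
qed (use j rho_Units in \<open>auto simp: refl_indices_iff intro!: hmap_s_closed\<close>)

lemma hmap_comm:
  assumes ij: "i \<in> refl_indices n" "j \<in> refl_indices n"
    and "\<not> [int i - int j = 1] (mod int n)" "\<not> [int i - int j = - 1] (mod int n)"
  shows "hmap (HS i) \<otimes> hmap (HS j) = hmap (HS j) \<otimes> hmap (HS i)"
proof -
  have n: "n \<ge> 2" "i < n" "j < n" using ij n_pos by (auto simp: refl_indices_iff)
  have nd: "\<not> int n dvd (int i - int j - 1)" "\<not> int n dvd (int i - int j + 1)"
    using assms by (simp_all add: cong_iff_dvd_diff)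
  \<comment> \<open>As \<open>i - j\<close> lies strictly between \<open>-n\<close> and
    \<open>n\<close>, these are all the values congruent to 1 or -1 modulo \<open>n\<close>.\<close>
  have ne: "int i - int j \<noteq> 1" "int i - int j \<noteq> -1" "int i - int j \<noteq> int n - 1" "int i - int j \<noteq> 1 - int n"
    using nd by auto
  consider "i = j" | "i = 0" "j \<noteq> 0" | "j = 0" "i \<noteq> 0" | "i \<noteq> j" "i \<noteq> 0" "j \<noteq> 0" by linarith
  then show ?thesis
  proof cases
    case 2
    then show ?thesis using hmap_comm_zero[of j] ne n by force
  next
    case 3
    then show ?thesis using hmap_comm_zero[of i] ne n by force
  next
    case 4
    then have "\<bar>int i - int j\<bar> \<ge> 2" using ne by linarith
    then show ?thesis using g_comm[of i j] n 4 by (simp add: hmap_def)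
  qed simp
qed

lemma hmap_braid_pred:
  assumes n: "n \<ge> 3" and i: "i < n" "j < n"
    and braid: "hmap (HS i) \<otimes> hmap (HS j) \<otimes> hmap (HS i) = hmap (HS j) \<otimes> hmap (HS i) \<otimes> hmap (HS j)"
    and pred: "i' = (i + (n - 1)) mod n" "j' = (j + (n - 1)) mod n"
  shows "hmap (HS i') \<otimes> hmap (HS j') \<otimes> hmap (HS i') = hmap (HS j') \<otimes> hmap (HS i') \<otimes> hmap (HS j')"
proof (rule intertwine_eq[where c = rho, OF braid])
  have mem: "i \<in> refl_indices n" "j \<in> refl_indices n" "i' \<in> refl_indices n" "j' \<in> refl_indices n"
    using n i by (auto simp: refl_indices_iff pred)
  then have c: "hmap (HS k) \<in> carrier B" if "k \<in> {i, j, i', j'}" for k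
    using that hmap_s_closed by auto
  have step: "rho \<otimes> hmap (HS i) = hmap (HS i') \<otimes> rho" "rho \<otimes> hmap (HS j) = hmap (HS j') \<otimes> rho"
    using rho_hmap_s mem pred by auto
  show "rho \<otimes> (hmap (HS i) \<otimes> hmap (HS j) \<otimes> hmap (HS i)) = hmap (HS i') \<otimes> hmap (HS j') \<otimes> hmap (HS i') \<otimes> rho"
    "rho \<otimes> (hmap (HS j) \<otimes> hmap (HS i) \<otimes> hmap (HS j)) = hmap (HS j') \<otimes> hmap (HS i') \<otimes> hmap (HS j') \<otimes> rho"
    using step c rho_Units by (auto intro!: intertwine_mult m_closed)
  show "hmap (HS i') \<otimes> hmap (HS j') \<otimes> hmap (HS i') \<in> carrier B"
    "hmap (HS j') \<otimes> hmap (HS i') \<otimes> hmap (HS j') \<in> carrier B"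
    using c by (auto intro!: m_closed)
qed (rule rho_Units)

text \<open>The relation for (1, 2), available as \<open>n >= 3\<close>, is conjugated by
  \<open>rho\<close> to (0, 1) and once more to (n - 1, 0), the two pairs that involve index
  0.\<close>

lemma hmap_braid:
  assumes n: "n \<ge> 3" and i: "i < n"
  shows "hmap (HS i) \<otimes> hmap (HS ((i + 1) mod n)) \<otimes> hmap (HS i) =
    hmap (HS ((i + 1) mod n)) \<otimes> hmap (HS i) \<otimes> hmap (HS ((i + 1) mod n))"
proof -
  have finite: "hmap (HS k) \<otimes> hmap (HS (k + 1)) \<otimes> hmap (HS k) =
      hmap (HS (k + 1)) \<otimes> hmap (HS k) \<otimes> hmap (HS (k + 1))" if "1 \<le> k" "k + 1 < n" for k
    using that g_braid[of k] by (simp add: hmap_def)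
  have zero: "hmap (HS 0) \<otimes> hmap (HS 1) \<otimes> hmap (HS 0) = hmap (HS 1) \<otimes> hmap (HS 0) \<otimes> hmap (HS 1)"
    by (rule hmap_braid_pred[of 1 "1 + 1", OF _ _ _ finite]) (use n in \<open>auto simp: mod_if\<close>)
  have last: "hmap (HS (n - 1)) \<otimes> hmap (HS 0) \<otimes> hmap (HS (n - 1)) =
      hmap (HS 0) \<otimes> hmap (HS (n - 1)) \<otimes> hmap (HS 0)"
    by (rule hmap_braid_pred[of 0 1, OF _ _ _ zero]) (use n in \<open>auto simp: mod_if\<close>)
  consider "i = 0" | "i = n - 1" | "1 \<le> i" "i + 1 < n" using i by linarith
  then show ?thesis
  proof cases
    case 1
    then show ?thesis using zero n by simp
  next
    case 2
    then show ?thesis using last n by simp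
  next
    case 3
    then show ?thesis using finite[of i] by simp
  qed
qed

text \<open>At index 0 this is the relation at index 1 conjugated by \<open>rho\<close>:
  \<open>T_1\<close> goes to \<open>T_0\<close>, \<open>t_1\<close> to \<open>t_n\<close> and
  \<open>t_2\<close> to \<open>t_1\<close>, hence \<open>e_1\<close> to \<open>e_0\<close>.\<close>

lemma hmap_quad:
  assumes i: "i \<in> refl_indices n"
  shows "hmap (HS i) \<otimes> hmap (HS i) = \<one> \<oplus> (qvar - qvar_inv) \<odot>
    (e_elem B r (hmap (t_index n i)) (hmap (t_index n (i + 1))) \<otimes> hmap (HS i))"
proof (cases "i = 0")
  case False
  then have "i \<in> {1..<n}" using i by (auto simp: refl_indices_iff)
  then show ?thesis using g_quad[of i] False by (simp add: hmap_simps t_index_def)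
next
  case True
  have n: "n \<ge> 2" using i n_pos by (auto simp: refl_indices_iff)
  let ?e1 = "e_elem B r (hmap (HT 1)) (hmap (HT 2))"
  let ?e0 = "e_elem B r (hmap (t_index n 0)) (hmap (t_index n 1))"
  let ?q = "qvar - qvar_inv"
  have c: "hmap (HS 0) \<in> carrier B" "hmap (HS 1) \<in> carrier B" "hmap (HT 1) \<in> carrier B"
    "hmap (HT 2) \<in> carrier B" "hmap (t_index n 0) \<in> carrier B" "hmap (t_index n 1) \<in> carrier B"
    "rho \<in> carrier B"
    using n rho_Units hmap_closed
    by (auto intro!: hmap_s_closed hmap_t_index_closed simp: refl_indices_iff)
  have s: "rho \<otimes> hmap (HS 1) = hmap (HS 0) \<otimes> rho"
    using rho_hmap_s[of 1] n by (simp add: refl_indices_iff)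
  have e: "rho \<otimes> ?e1 = ?e0 \<otimes> rho"
    using rho_hmap_t[of 1] rho_hmap_t[of 2] n c by (intro intertwine_e_elem) auto
  have es: "rho \<otimes> (?e1 \<otimes> hmap (HS 1)) = ?e0 \<otimes> hmap (HS 0) \<otimes> rho"
    by (rule intertwine_mult[OF e s]) (use c in auto)
  have "hmap (HS 0) \<otimes> hmap (HS 0) = \<one> \<oplus> ?q \<odot> (?e0 \<otimes> hmap (HS 0))"
  proof (rule intertwine_eq[where c = rho])
    show "hmap (HS 1) \<otimes> hmap (HS 1) = \<one> \<oplus> ?q \<odot> (?e1 \<otimes> hmap (HS 1))"
      using g_quad[of 1] n by (simp add: hmap_def numeral_2_eq_2)
    show "rho \<otimes> (hmap (HS 1) \<otimes> hmap (HS 1)) = hmap (HS 0) \<otimes> hmap (HS 0) \<otimes> rho"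
      using s s by (rule intertwine_mult) (use c in auto)
    show "rho \<otimes> (\<one> \<oplus> ?q \<odot> (?e1 \<otimes> hmap (HS 1))) = (\<one> \<oplus> ?q \<odot> (?e0 \<otimes> hmap (HS 0))) \<otimes> rho"
      using c es qdiff_mem by (simp add: r_distr l_distr smult_mult_l smult_mult_r)
  qed (use c qdiff_mem rho_Units in auto)
  then show ?thesis using True by simp
qed

text \<open>With the universal property, this is the well-definedness of
  \<open>\<Phi>\<close>.\<close>

lemma hecke_rep_hmap: "hecke_rep r B n hmap"
proof unfold_locales
  show "n \<ge> 1" by (rule n_pos)
  show "hmap \<in> hgens n \<rightarrow> carrier B" by (rule hmap_closed)
  have t_index: "t_index n j \<in> hgens n" if "j \<le> n" for j
    using that n_pos by (auto simp: t_index_def)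
  have inv: "rho \<otimes> inv rho = \<one>" "inv rho \<otimes> rho = \<one>" using rho_Units by auto
  have refl: "i \<in> refl_indices n" if "i \<in> {1..<n}" for i using that by (auto simp: refl_indices_iff)
  fix u v assume "hrel r n u v"
  then show "free_eval B hmap u = free_eval B hmap v"
  proof cases
    case (t_pow i)
    then show ?thesis
      using yokonuma_rep.t_pow[OF yokonuma_rep_axioms, of i] by (simp add: free_eval_simps[OF hmap_closed] hmap_simps)
  next
    case (t_comm i j)
    then show ?thesis
      using yokonuma_rep.t_comm[OF yokonuma_rep_axioms, of i j] by (simp add: free_eval_simps[OF hmap_closed] hmap_simps)
  next
    case (T_t i j)
    then show ?thesis
      using g_t[of i j] transpose_mem[of i n j] refl[of i]
      by (simp add: free_eval_simps[OF hmap_closed] hmap_simps)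
  next
    case (rho_t j)
    then have "t_index n (j - 1) \<in> hgens n" by (intro t_index) auto
    with rho_t show ?thesis
      using rho_hmap_t[of j] by (simp add: free_eval_simps[OF hmap_closed] hmap_simps(4))
  next
    case (rho_T i)
    then show ?thesis
      using rho_hmap_s[of i] by (simp add: free_eval_simps[OF hmap_closed] hmap_simps(4) refl_indices_iff)
  next
    case (T_comm i j)
    then show ?thesis
      using hmap_comm[of i j] by (simp add: free_eval_simps[OF hmap_closed])
  next
    case (T_braid i)
    then show ?thesis
      using hmap_braid[of i] by (simp add: free_eval_simps[OF hmap_closed] refl_indices_iff)
  next
    case (T_quad i)
    then have "t_index n i \<in> hgens n" "t_index n (i + 1) \<in> hgens n"
      by (auto intro!: t_index simp: refl_indices_iff)
    with T_quad show ?thesis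
      using hmap_quad[of i]
      by (simp add: free_eval_gen_square[OF hmap_closed] free_eval_quadratic[OF hmap_closed])
  next
    case rho_rhoinv
    then show ?thesis using inv by (simp add: free_eval_simps[OF hmap_closed] hmap_simps)
  next
    case rhoinv_rho
    then show ?thesis using inv by (simp add: free_eval_simps[OF hmap_closed] hmap_simps)
  qed
qed

end

section \<open>The map on generators from the Bernstein form\<close>

context hecke_rep
begin

text \<open>The solution of \<open>D X = T_rho\<close>, spelled with individual inverses as in the
  theorem; computations use the form in \<open>X_altdef\<close>.\<close>

definition X :: 'a where
  "X = list_prod B (map (\<lambda>i. inv \<phi> (HS i)) [1..<n]) \<otimes> \<phi> HRho"

definition ymap :: "ygen \<Rightarrow> 'a" where
  "ymap x = (case x of YT j \<Rightarrow> \<phi> (HT j) | YG i \<Rightarrow> \<phi> (HS i) | YX \<Rightarrow> X | YXinv \<Rightarrow> inv X)"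

lemma ymap_simps [simp]:
  "ymap (YT j) = \<phi> (HT j)" "ymap (YG i) = \<phi> (HS i)" "ymap YX = X" "ymap YXinv = inv X"
  by (simp_all add: ymap_def)

lemma rho_Units: "\<phi> HRho \<in> Units B"
  using rho_closed rhoinv_closed rho_rhoinv rhoinv_rho by (auto simp: Units_def)

lemma inv_rho: "inv \<phi> HRho = \<phi> HRhoinv"
  using rho_closed rhoinv_closed rho_rhoinv rhoinv_rho by (intro inv_unique'[symmetric]) auto

lemma X_altdef: "X = inv (gprod (rev [1..<n])) \<otimes> \<phi> HRho"
  by (simp add: X_def inv_gprod_rev)

lemma descending_Units: "gprod (rev [1..<n]) \<in> Units B"
  by (intro gprod_Units) auto

lemma X_Units: "X \<in> Units B"
  unfolding X_altdef using descending_Units rho_Units by auto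

lemma inv_X: "inv X = \<phi> HRhoinv \<otimes> gprod (rev [1..<n])"
  unfolding X_altdef using descending_Units rho_Units
  by (simp add: inv_mult_Units inv_rho)

lemma descending_X: "gprod (rev [1..<n]) \<otimes> X = \<phi> HRho"
  unfolding X_altdef using descending_Units rho_closed
  by (simp add: m_assoc[symmetric] Units_closed)

lemma ymap_closed: "ymap \<in> ygens n \<rightarrow> carrier B"
proof
  fix x assume "x \<in> ygens n"
  then show "ymap x \<in> carrier B"
    using X_Units by (cases x) (auto intro!: t_closed g_closed)
qed

text \<open>After multiplication by the unit \<open>D\<close> on the left, both sides become
  \<open>T_(i-1) T_rho\<close>.\<close>

lemma s_X:
  assumes i: "i \<in> {2..<n}"
  shows "\<phi> (HS i) \<otimes> X = X \<otimes> \<phi> (HS i)"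
proof -
  let ?D = "gprod (rev [1..<n])"
  have c: "?D \<in> carrier B" "X \<in> carrier B" "\<phi> (HS i) \<in> carrier B" "\<phi> (HS (i - 1)) \<in> carrier B"
    using i descending_Units X_Units by (auto intro!: g_closed)
  have "2 \<le> i" "i < n" using i by auto
  then have "(i + (n - 1)) mod n = i - 1" by (simp add: mod_if)
  then have rho: "\<phi> HRho \<otimes> \<phi> (HS i) = \<phi> (HS (i - 1)) \<otimes> \<phi> HRho"
    using rho_s[of i] i by (auto simp: refl_indices_iff)
  have D: "?D \<otimes> \<phi> (HS i) = \<phi> (HS (i - 1)) \<otimes> ?D"
    using i by (intro gprod_descending_g) auto
  have "?D \<otimes> (\<phi> (HS i) \<otimes> X) = \<phi> (HS (i - 1)) \<otimes> \<phi> HRho"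
    using c D by (metis m_assoc descending_X)
  also have "\<dots> = ?D \<otimes> (X \<otimes> \<phi> (HS i))"
    using c rho by (metis m_assoc descending_X)
  finally show ?thesis
    using descending_Units c by simp
qed

text \<open>\<open>D\<close> and \<open>T_rho\<close> permute the \<open>t_j\<close> by the same
  cycle, so \<open>X = D^-1 T_rho\<close> fixes each of them under conjugation.\<close>

lemma t_X:
  assumes j: "j \<in> {1..n}"
  shows "\<phi> (HT j) \<otimes> X = X \<otimes> \<phi> (HT j)"
proof -
  let ?D = "gprod (rev [1..<n])" and ?k = "if j = 1 then n else j - 1"
  have "?k \<in> {1..n}" using j by auto
  then have c: "?D \<in> carrier B" "X \<in> carrier B" "\<phi> (HT j) \<in> carrier B" "\<phi> (HT ?k) \<in> carrier B"
    using j descending_Units X_Units t_closed by auto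
  have rho: "\<phi> HRho \<otimes> \<phi> (HT j) = \<phi> (HT ?k) \<otimes> \<phi> HRho"
    using rho_t[of j] j by (auto simp: t_index_def split: if_splits)
  have D: "?D \<otimes> \<phi> (HT j) = \<phi> (HT ?k) \<otimes> ?D"
    using gprod_descending_t[of n j] j n_pos by auto
  have "?D \<otimes> (\<phi> (HT j) \<otimes> X) = \<phi> (HT ?k) \<otimes> \<phi> HRho"
    using c D by (metis m_assoc descending_X)
  also have "\<dots> = ?D \<otimes> (X \<otimes> \<phi> (HT j))"
    using c rho by (metis m_assoc descending_X)
  finally show ?thesis
    using descending_Units c by simp
qed

text \<open>Two rotations take \<open>T_1\<close> through \<open>T_0\<close> to
  \<open>T_(n-1)\<close>. This is the equation for \<open>rho^2\<close> from which the braid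
  relation was recovered.\<close>

lemma X_braid:
  assumes n: "1 < n"
  shows "\<phi> (HS 1) \<otimes> X \<otimes> \<phi> (HS 1) \<otimes> X = X \<otimes> \<phi> (HS 1) \<otimes> X \<otimes> \<phi> (HS 1)"
proof (rule braid_if_rho_squared_g)
  have c: "\<phi> HRho \<in> carrier B" "\<phi> (HS 0) \<in> carrier B" "\<phi> (HS 1) \<in> carrier B" "\<phi> (HS (n - 1)) \<in> carrier B"
    using n rho_closed by (auto intro!: s_closed simp: refl_indices_iff)
  have "\<phi> HRho \<otimes> \<phi> (HS 1) = \<phi> (HS 0) \<otimes> \<phi> HRho" "\<phi> HRho \<otimes> \<phi> (HS 0) = \<phi> (HS (n - 1)) \<otimes> \<phi> HRho"
    using rho_s[of 1] rho_s[of 0] n by (auto simp: refl_indices_iff)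
  then have "\<phi> HRho \<otimes> \<phi> HRho \<otimes> \<phi> (HS 1) = \<phi> (HS (n - 1)) \<otimes> (\<phi> HRho \<otimes> \<phi> HRho)"
    using c by (metis m_assoc)
  then show "gprod (rev [1..<n]) \<otimes> X \<otimes> (gprod (rev [1..<n]) \<otimes> X) \<otimes> \<phi> (HS 1) =
      \<phi> (HS (n - 1)) \<otimes> (gprod (rev [1..<n]) \<otimes> X \<otimes> (gprod (rev [1..<n]) \<otimes> X))"
    unfolding descending_X .
qed (use n X_Units s_X g_Units in auto)

text \<open>With the universal property, this is the well-definedness of
  \<open>\<Psi>\<close>.\<close>

lemma yokonuma_rep_ymap: "yokonuma_rep r B n ymap"
proof unfold_locales
  show "n \<ge> 1" by (rule n_pos)
  show "ymap \<in> ygens n \<rightarrow> carrier B" by (rule ymap_closed)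
  have inv: "X \<otimes> inv X = \<one>" "inv X \<otimes> X = \<one>" using X_Units by auto
  fix u v assume "yrel r n u v"
  then show "free_eval B ymap u = free_eval B ymap v"
  proof cases
    case (g_comm i j)
    then show ?thesis using s_comm[of i j] by (simp add: free_eval_simps[OF ymap_closed])
  next
    case (g_braid i)
    then show ?thesis using s_braid[of i] by (simp add: free_eval_simps[OF ymap_closed])
  next
    case (t_comm i j)
    then show ?thesis
      using hecke_rep.t_comm[OF hecke_rep_axioms, of i j] by (simp add: free_eval_simps[OF ymap_closed])
  next
    case (g_t i j)
    then show ?thesis
      using s_t[of i j] transpose_mem[of i n j] by (simp add: free_eval_simps[OF ymap_closed])
  next
    case (t_pow i)
    then show ?thesis
      using hecke_rep.t_pow[OF hecke_rep_axioms, of i] by (simp add: free_eval_simps[OF ymap_closed])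
  next
    case (g_quad i)
    then show ?thesis
      using s_quad[of i]
      by (simp add: free_eval_gen_square[OF ymap_closed] free_eval_quadratic[OF ymap_closed])
  next
    case X_Xinv
    then show ?thesis using inv by (simp add: free_eval_simps[OF ymap_closed])
  next
    case Xinv_X
    then show ?thesis using inv by (simp add: free_eval_simps[OF ymap_closed])
  next
    case g_X_braid
    then show ?thesis using X_braid by (simp add: free_eval_simps[OF ymap_closed])
  next
    case (g_X i)
    then show ?thesis using s_X[of i] by (simp add: free_eval_simps[OF ymap_closed])
  next
    case (t_X j)
    then show ?thesis
      using hecke_rep.t_X[OF hecke_rep_axioms, of j] by (simp add: free_eval_simps[OF ymap_closed])
  qed
qed

end


text \<open>With \<open>A = g_(n-1) ... g_2\<close> and \<open>A' = g_2 ... g_(n-1)\<close>, the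
  product \<open>T_0 D A'\<close> equals \<open>rho g_1 X_1^-1 A' = A g_1 X_1 g_1 X_1^-1 A'\<close>.
  The braid relation moves \<open>X_1^-1\<close> to the left of \<open>g_1 X_1 g_1\<close>, and it
  then commutes past \<open>A\<close>. The bracketed factor in the statement is \<open>X_n\<close>
  written out.\<close>

lemma (in yokonuma_rep) hmap_zero:
  assumes n: "n \<ge> 2"
  shows "hmap (HS 0) = \<phi> YXinv \<otimes> (gprod (rev [1..<n]) \<otimes> \<phi> YX \<otimes> gprod [1..<n]) \<otimes>
    inv (gprod (rev [1..<n] @ [2..<n]))"
proof -
  let ?D = "gprod (rev [1..<n])" and ?A = "gprod (rev [2..<n])" and ?A' = "gprod [2..<n]"
  let ?g = "\<phi> (YG 1)" and ?X = "\<phi> YX" and ?X' = "\<phi> YXinv"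
  have c: "?D \<in> carrier B" "?A \<in> carrier B" "?A' \<in> carrier B" "?g \<in> carrier B" "inv ?D \<in> carrier B"
    "rho \<in> carrier B" "inv rho \<in> carrier B"
    using n rho_Units by (auto intro!: gprod_closed g_closed Units_inv_closed gprod_Units)
  note c = c X_closed Xinv_closed
  have Q: "gprod (rev [1..<n] @ [2..<n]) = ?D \<otimes> ?A'" "?D \<otimes> ?A' \<in> Units B"
    by (auto intro!: gprod_append Units_m_closed gprod_Units)
  have X': "?X' \<otimes> (?X \<otimes> y) = y" "?X \<otimes> (?X' \<otimes> y) = y" if "y \<in> carrier B" for y
    using that c by (simp_all add: m_assoc[symmetric] X_Xinv Xinv_X)
  have X'A: "?X' \<otimes> ?A = ?A \<otimes> ?X'"
  proof -
    have "?X \<otimes> ?A = ?A \<otimes> ?X"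
      unfolding gprod_def
      by (rule intertwine_list_prod) (use X_closed g_X in \<open>auto intro!: g_closed\<close>)
    then have "?X' \<otimes> (?X \<otimes> ?A) \<otimes> ?X' = ?X' \<otimes> (?A \<otimes> ?X) \<otimes> ?X'" by simp
    then show ?thesis using c by (simp add: X' X_Xinv m_assoc)
  qed
  \<comment> \<open>The relation between \<open>g_1\<close> and \<open>X_1\<close>, multiplied by
    \<open>X_1^-1\<close> on both sides.\<close>
  have braid: "?X' \<otimes> (?g \<otimes> (?X \<otimes> ?g)) = ?g \<otimes> (?X \<otimes> (?g \<otimes> ?X'))"
  proof -
    have "?X' \<otimes> (?g \<otimes> ?X \<otimes> ?g \<otimes> ?X) \<otimes> ?X' = ?X' \<otimes> (?X \<otimes> ?g \<otimes> ?X \<otimes> ?g) \<otimes> ?X'"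
      using X_braid n by simp
    then show ?thesis using c by (simp add: X' X_Xinv m_assoc)
  qed
  have "inv rho \<otimes> ?D = ?X'"
    unfolding rho_def using c by (simp add: inv_mult_Units gprod_Units X_Units inv_X m_assoc)
  then have "hmap (HS 0) \<otimes> (?D \<otimes> ?A') = rho \<otimes> ?g \<otimes> ?X' \<otimes> ?A'"
    using c by (metis hmap_simps(2) m_assoc m_closed)
  also have "\<dots> = ?A \<otimes> (?g \<otimes> (?X \<otimes> (?g \<otimes> ?X'))) \<otimes> ?A'"
    unfolding rho_def gprod_descending_split[OF n] using c by (simp add: m_assoc)
  also have "\<dots> = ?A \<otimes> (?X' \<otimes> (?g \<otimes> (?X \<otimes> ?g))) \<otimes> ?A'"
    unfolding braid ..
  also have "\<dots> = (?A \<otimes> ?X') \<otimes> (?g \<otimes> (?X \<otimes> (?g \<otimes> ?A')))"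
    using c by (simp add: m_assoc)
  also have "\<dots> = ?X' \<otimes> (?D \<otimes> ?X \<otimes> gprod [1..<n])"
    unfolding X'A[symmetric] gprod_descending_split[OF n] gprod_ascending_split[OF n]
    using c by (simp add: m_assoc)
  finally have "hmap (HS 0) \<otimes> (?D \<otimes> ?A') \<otimes> inv (?D \<otimes> ?A') =
      ?X' \<otimes> (?D \<otimes> ?X \<otimes> gprod [1..<n]) \<otimes> inv (?D \<otimes> ?A')" by simp
  moreover have "hmap (HS 0) \<in> carrier B"
    using n by (intro hmap_s_closed) (simp add: refl_indices_iff)
  ultimately show ?thesis
    using Q by (simp add: m_assoc Units_closed)
qed

section \<open>Homomorphisms out of the presented algebras\<close>

context laurent_coeffs
begin

lemma presentation_yrel: "presentation (laurent_ring r) (ygens n) (yrel r n)"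
proof unfold_locales
  fix u v assume "yrel r n u v"
  then show "u \<in> carrier (free_algebra (laurent_ring r) (ygens n)) \<and>
      v \<in> carrier (free_algebra (laurent_ring r) (ygens n))"
    by cases (auto intro!: free_mem_simps e_idem_in_free_algebra simp: Transposition.transpose_def)
qed

lemma presentation_hrel:
  assumes "n \<ge> 1"
  shows "presentation (laurent_ring r) (hgens n) (hrel r n)"
proof unfold_locales
  fix u v assume "hrel r n u v"
  then show "u \<in> carrier (free_algebra (laurent_ring r) (hgens n)) \<and>
      v \<in> carrier (free_algebra (laurent_ring r) (hgens n))"
    by cases (use assms in \<open>auto intro!: free_mem_simps e_idem_in_free_algebra
        simp: Transposition.transpose_def t_index_def refl_indices_iff\<close>)
qed

text \<open>The presented algebra represents its own relations, so all identities proved for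
  representations hold among its generators.\<close>

lemma yokonuma_rep_Ygen:
  assumes "n \<ge> 1"
  shows "yokonuma_rep r (Yaff r n) n (Ygen r n)"
proof -
  interpret P: presentation "laurent_ring r" "ygens n" "yrel r n" by (rule presentation_yrel)
  show ?thesis
    unfolding Yaff_def Ygen_def
    by (intro yokonuma_rep.intro laurent_algebra.intro yokonuma_rep_axioms.intro laurent_coeffs_axioms
        P.presented_assoc_algebra P.presented_gen_closed P.presented_gen_rel assms)
qed

lemma hecke_rep_Hgen:
  assumes "n \<ge> 1"
  shows "hecke_rep r (Haff r n) n (Hgen r n)"
proof -
  interpret P: presentation "laurent_ring r" "hgens n" "hrel r n" by (rule presentation_hrel[OF assms])
  show ?thesis
    unfolding Haff_def Hgen_def
    by (intro hecke_rep.intro laurent_algebra.intro hecke_rep_axioms.intro laurent_coeffs_axioms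
        P.presented_assoc_algebra P.presented_gen_closed P.presented_gen_rel assms)
qed

lemma Yaff_hom_unique:
  assumes "assoc_algebra (laurent_ring r) B"
    "h \<in> algebra_hom (laurent_ring r) (Yaff r n) B" "k \<in> algebra_hom (laurent_ring r) (Yaff r n) B"
    "\<And>x. x \<in> ygens n \<Longrightarrow> h (Ygen r n x) = k (Ygen r n x)" "y \<in> carrier (Yaff r n)"
  shows "h y = k y"
  using presentation.presented_hom_unique[OF presentation_yrel assms(1)] assms(2-)
  unfolding Yaff_def Ygen_def by blast

lemma Haff_hom_unique:
  assumes "n \<ge> 1" "assoc_algebra (laurent_ring r) B"
    "h \<in> algebra_hom (laurent_ring r) (Haff r n) B" "k \<in> algebra_hom (laurent_ring r) (Haff r n) B"
    "\<And>x. x \<in> hgens n \<Longrightarrow> h (Hgen r n x) = k (Hgen r n x)" "y \<in> carrier (Haff r n)"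
  shows "h y = k y"
  using presentation.presented_hom_unique[OF presentation_hrel[OF assms(1)] assms(2)] assms(3-)
  unfolding Haff_def Hgen_def by blast

end

lemma (in yokonuma_rep) Yaff_hom_exists:
  obtains h where "h \<in> algebra_hom (laurent_ring r) (Yaff r n) B"
    "\<And>x. x \<in> ygens n \<Longrightarrow> h (Ygen r n x) = \<phi> x"
  using presentation.presented_hom_exists[OF presentation_yrel assoc_algebra_axioms \<phi> rel] that
  unfolding Yaff_def Ygen_def by blast

lemma (in hecke_rep) Haff_hom_exists:
  obtains h where "h \<in> algebra_hom (laurent_ring r) (Haff r n) B"
    "\<And>x. x \<in> hgens n \<Longrightarrow> h (Hgen r n x) = \<phi> x"
  using presentation.presented_hom_exists[OF presentation_hrel[OF n_pos] assoc_algebra_axioms \<phi> rel] that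
  unfolding Haff_def Hgen_def by blast

context ring_hom_ring
begin

lemma hom_list_prod:
  "set xs \<subseteq> carrier R \<Longrightarrow> h (list_prod R xs) = list_prod S (map h xs)"
  by (induction xs) auto

lemma hom_inv_Units:
  assumes "x \<in> Units R"
  shows "h (inv\<^bsub>R\<^esub> x) = inv\<^bsub>S\<^esub> (h x)"
proof (rule S.inv_unique')
  have c: "x \<in> carrier R" "inv\<^bsub>R\<^esub> x \<in> carrier R" using assms by auto
  then show "h x \<in> carrier S" "h (inv\<^bsub>R\<^esub> x) \<in> carrier S" by auto
  show "h x \<otimes>\<^bsub>S\<^esub> h (inv\<^bsub>R\<^esub> x) = \<one>\<^bsub>S\<^esub>" "h (inv\<^bsub>R\<^esub> x) \<otimes>\<^bsub>S\<^esub> h x = \<one>\<^bsub>S\<^esub>"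
    using c assms by (simp_all flip: hom_mult)
qed

end

text \<open>The recursion adds \<open>g_i\<close> on both outer sides, so the factors descend to the
  left of \<open>X_1\<close> and ascend to its right. The induction starts at 1 because the value at
  0 is a placeholder.\<close>

lemma YXs_eq:
  assumes "yokonuma_rep r (Yaff r n) n (Ygen r n)" and k: "1 \<le> k" "k \<le> n"
  shows "YXs r n k = list_prod (Yaff r n) (map (\<lambda>i. Ygen r n (YG i)) (rev [1..<k]))
    \<otimes>\<^bsub>Yaff r n\<^esub> Ygen r n YX
    \<otimes>\<^bsub>Yaff r n\<^esub> list_prod (Yaff r n) (map (\<lambda>i. Ygen r n (YG i)) [1..<k])"
proof -
  interpret Y: yokonuma_rep r "Yaff r n" n "Ygen r n" by fact
  from k have "YXs r n k = Y.gprod (rev [1..<k]) \<otimes>\<^bsub>Yaff r n\<^esub> Ygen r n YX \<otimes>\<^bsub>Yaff r n\<^esub> Y.gprod [1..<k]"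
  proof (induction k rule: dec_induct)
    case base
    then show ?case using Y.X_closed by (simp add: Y.gprod_def)
  next
    case (step k)
    have c: "Ygen r n (YG k) \<in> carrier (Yaff r n)" "Y.gprod (rev [1..<k]) \<in> carrier (Yaff r n)"
      "Y.gprod [1..<k] \<in> carrier (Yaff r n)"
      using step by (auto intro!: Y.g_closed Y.gprod_closed)
    have "Y.gprod [1..<Suc k] = Y.gprod [1..<k] \<otimes>\<^bsub>Yaff r n\<^esub> Ygen r n (YG k)"
      using Y.gprod_append[of "[1..<k]" "[k]"] Y.gprod_single[of k] step by auto
    then show ?case
      using step c Y.X_closed Y.gprod_descending_Suc[of k] by (simp add: Y.m_assoc)
  qed
  then show ?thesis by (simp add: Y.gprod_def)
qed

theorem theorem2p5:
  fixes r n :: nat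
  assumes "r \<ge> 1" and "n \<ge> 1"
  shows "\<exists>\<Phi> \<Psi>.
    \<Phi> \<in> algebra_iso (laurent_ring r) (Haff r n) (Yaff r n) \<and>
    \<Psi> \<in> algebra_iso (laurent_ring r) (Yaff r n) (Haff r n) \<and>
    (\<forall>x \<in> carrier (Haff r n). \<Psi> (\<Phi> x) = x) \<and>
    (\<forall>y \<in> carrier (Yaff r n). \<Phi> (\<Psi> y) = y) \<and>
    (\<forall>j \<in> {1..n}. \<Phi> (Hgen r n (HT j)) = Ygen r n (YT j)) \<and>
    (\<forall>i \<in> {1..<n}. \<Phi> (Hgen r n (HS i)) = Ygen r n (YG i)) \<and>
    (n \<ge> 2 \<longrightarrow>
      \<Phi> (Hgen r n (HS 0)) =
        Ygen r n YXinv \<otimes>\<^bsub>Yaff r n\<^esub> YXs r n n \<otimes>\<^bsub>Yaff r n\<^esub>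
        inv\<^bsub>Yaff r n\<^esub> (list_prod (Yaff r n)
          (map (\<lambda>i. Ygen r n (YG i)) (rev [1..<n] @ [2..<n])))) \<and>
    \<Phi> (Hgen r n HRho) =
      list_prod (Yaff r n) (map (\<lambda>i. Ygen r n (YG i)) (rev [1..<n])) \<otimes>\<^bsub>Yaff r n\<^esub> Ygen r n YX \<and>
    \<Phi> (Hgen r n HRhoinv) =
      Ygen r n YXinv \<otimes>\<^bsub>Yaff r n\<^esub>
      list_prod (Yaff r n) (map (\<lambda>i. inv\<^bsub>Yaff r n\<^esub> Ygen r n (YG i)) [1..<n]) \<and>
    (\<forall>j \<in> {1..n}. \<Psi> (Ygen r n (YT j)) = Hgen r n (HT j)) \<and>
    (\<forall>i \<in> {1..<n}. \<Psi> (Ygen r n (YG i)) = Hgen r n (HS i)) \<and>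
    \<Psi> (Ygen r n YX) =
      list_prod (Haff r n) (map (\<lambda>i. inv\<^bsub>Haff r n\<^esub> Hgen r n (HS i)) [1..<n])
      \<otimes>\<^bsub>Haff r n\<^esub> Hgen r n HRho \<and>
    \<Psi> (Ygen r n YXinv) =
      Hgen r n HRhoinv \<otimes>\<^bsub>Haff r n\<^esub>
      list_prod (Haff r n) (map (\<lambda>i. Hgen r n (HS i)) (rev [1..<n]))"
proof -
  interpret laurent_coeffs r using assms(1) by unfold_locales
  interpret Y: yokonuma_rep r "Yaff r n" n "Ygen r n" using assms(2) by (rule yokonuma_rep_Ygen)
  interpret H: hecke_rep r "Haff r n" n "Hgen r n" using assms(2) by (rule hecke_rep_Hgen)
  obtain \<Phi> where \<Phi>: "\<Phi> \<in> algebra_hom (laurent_ring r) (Haff r n) (Yaff r n)"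
    and \<Phi>_gen: "\<And>x. x \<in> hgens n \<Longrightarrow> \<Phi> (Hgen r n x) = Y.hmap x"
    using hecke_rep.Haff_hom_exists[OF Y.hecke_rep_hmap] by blast
  obtain \<Psi> where \<Psi>: "\<Psi> \<in> algebra_hom (laurent_ring r) (Yaff r n) (Haff r n)"
    and \<Psi>_gen: "\<And>x. x \<in> ygens n \<Longrightarrow> \<Psi> (Ygen r n x) = H.ymap x"
    using yokonuma_rep.Yaff_hom_exists[OF H.yokonuma_rep_ymap] by blast
  interpret \<Phi>: ring_hom_ring "Haff r n" "Yaff r n" \<Phi>
    using \<Phi> by (intro ring_hom_ringI2 algebra_hom_ring_hom H.ring_axioms Y.ring_axioms)
  interpret \<Psi>: ring_hom_ring "Yaff r n" "Haff r n" \<Psi>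
    using \<Psi> by (intro ring_hom_ringI2 algebra_hom_ring_hom H.ring_axioms Y.ring_axioms)
  have \<Phi>_s: "\<Phi> (Hgen r n (HS i)) = Ygen r n (YG i)" if "i \<in> {1..<n}" for i
    using that \<Phi>_gen by (auto simp: Y.hmap_simps refl_indices_iff)
  have \<Psi>_g: "\<Psi> (Ygen r n (YG i)) = Hgen r n (HS i)" if "i \<in> {1..<n}" for i
    using that \<Psi>_gen by simp
  have \<Phi>_gprod: "\<Phi> (H.gprod xs) = Y.gprod xs" if "set xs \<subseteq> {1..<n}" for xs
  proof -
    have "\<Phi> (H.gprod xs) = list_prod (Yaff r n) (map \<Phi> (map (\<lambda>i. Hgen r n (HS i)) xs))"
      unfolding H.gprod_def by (rule \<Phi>.hom_list_prod) (use that H.g_closed in fastforce)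
    also have "map \<Phi> (map (\<lambda>i. Hgen r n (HS i)) xs) = map (\<lambda>i. Ygen r n (YG i)) xs"
      unfolding map_map comp_def by (rule map_cong[OF refl], rule \<Phi>_s) (use that in blast)
    finally show ?thesis by (simp add: Y.gprod_def)
  qed
  have \<Psi>_gprod: "\<Psi> (Y.gprod xs) = H.gprod xs" if "set xs \<subseteq> {1..<n}" for xs
  proof -
    have "\<Psi> (Y.gprod xs) = list_prod (Haff r n) (map \<Psi> (map (\<lambda>i. Ygen r n (YG i)) xs))"
      unfolding Y.gprod_def by (rule \<Psi>.hom_list_prod) (use that Y.g_closed in fastforce)
    also have "map \<Psi> (map (\<lambda>i. Ygen r n (YG i)) xs) = map (\<lambda>i. Hgen r n (HS i)) xs"
      unfolding map_map comp_def by (rule map_cong[OF refl], rule \<Psi>_g) (use that in blast)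
    finally show ?thesis by (simp add: H.gprod_def)
  qed
  have desc: "set (rev [1..<n]) \<subseteq> {1..<n}" by auto
  \<comment> \<open>The image of \<open>D X_1\<close> is the corresponding product \<open>D\<close>
    of the \<open>T_i\<close> times \<open>X\<close>, and \<open>X\<close> was chosen to make this
    \<open>T_rho\<close>.\<close>
  have \<Psi>_rho: "\<Psi> Y.rho = Hgen r n HRho"
    using desc H.descending_X
    by (simp add: Y.rho_def \<Psi>.hom_mult Y.gprod_closed Y.X_closed \<Psi>_gprod \<Psi>_gen)
  \<comment> \<open>The image of \<open>D^-1 T_rho\<close> is
    \<open>D^-1 rho = D^-1 D X_1\<close>.\<close>
  have \<Phi>_X: "\<Phi> H.X = Ygen r n YX"
  proof -
    let ?D = "Y.gprod (rev [1..<n])"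
    have D: "?D \<in> Units (Yaff r n)" using desc by (rule Y.gprod_Units)
    have "\<Phi> H.X = inv\<^bsub>Yaff r n\<^esub> ?D \<otimes>\<^bsub>Yaff r n\<^esub> Y.rho"
      unfolding H.X_altdef using H.descending_Units H.rho_closed \<Phi>_gprod[OF desc] \<Phi>_gen[of HRho]
      by (simp only: \<Phi>.hom_mult H.Units_inv_closed \<Phi>.hom_inv_Units Y.hmap_simps hgens_iff)
    then show ?thesis
      using D Y.X_closed by (simp only: Y.rho_def Y.m_assoc[symmetric] Y.Units_closed
          Y.Units_inv_closed Y.Units_l_inv Y.l_one)
  qed
  have \<Psi>\<Phi>_gen: "\<Psi> (\<Phi> (Hgen r n x)) = Hgen r n x" if x: "x \<in> hgens n" for x
  proof (cases x)
    case (HS i)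
    show ?thesis
    proof (cases "i = 0")
      case True
      have n: "n \<ge> 2" using x HS assms(2) by (auto simp: refl_indices_iff)
      then have c: "Hgen r n (HS 0) \<in> carrier (Haff r n)" "Ygen r n (YG 1) \<in> carrier (Yaff r n)"
        using H.s_closed[of 0] Y.g_closed[of 1] by (auto simp: refl_indices_iff)
      \<comment> \<open>The conjugate \<open>rho g_1 rho^-1\<close> returns to
        \<open>T_rho T_1 T_rho^-1\<close>, which is \<open>T_0\<close> by the rotation relation at
        index 1.\<close>
      have "\<Psi> (Y.hmap (HS 0)) =
          Hgen r n HRho \<otimes>\<^bsub>Haff r n\<^esub> Hgen r n (HS 1) \<otimes>\<^bsub>Haff r n\<^esub> inv\<^bsub>Haff r n\<^esub> Hgen r n HRho"
        using c Y.rho_Units n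
        by (simp add: Y.hmap_simps \<Psi>.hom_mult Y.Units_closed \<Psi>.hom_inv_Units \<Psi>_rho \<Psi>_gen)
      also have "\<dots> = Hgen r n (HS 0)"
        using H.rho_s[of 1] H.rho_Units c n by (simp add: H.m_assoc H.Units_closed refl_indices_iff)
      finally show ?thesis
        using x HS True \<Phi>_gen by simp
    qed (use x HS \<Phi>_gen \<Psi>_gen in \<open>auto simp: Y.hmap_simps refl_indices_iff\<close>)
  qed (use x \<Phi>_gen \<Psi>_gen Y.rho_Units in
      \<open>auto simp: Y.hmap_simps \<Psi>_rho \<Psi>.hom_inv_Units H.inv_rho\<close>)
  have \<Phi>\<Psi>_gen: "\<Phi> (\<Psi> (Ygen r n x)) = Ygen r n x" if x: "x \<in> ygens n" for x
    by (cases x) (use x \<Phi>_gen \<Psi>_gen \<Phi>_s H.X_Units in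
        \<open>auto simp: Y.hmap_simps \<Phi>_X \<Phi>.hom_inv_Units Y.inv_X\<close>)
  \<comment> \<open>The composite and the identity agree on generators, which determine a
    homomorphism out of a presented algebra.\<close>
  have \<Psi>\<Phi>: "\<Psi> (\<Phi> x) = x" if "x \<in> carrier (Haff r n)" for x
    using Haff_hom_unique[OF assms(2) H.assoc_algebra_axioms algebra_hom_compose[OF \<Phi> \<Psi>] algebra_hom_id _ that]
      \<Psi>\<Phi>_gen by simp
  have \<Phi>\<Psi>: "\<Phi> (\<Psi> y) = y" if "y \<in> carrier (Yaff r n)" for y
    using Yaff_hom_unique[OF Y.assoc_algebra_axioms algebra_hom_compose[OF \<Psi> \<Phi>] algebra_hom_id _ that]
      \<Phi>\<Psi>_gen by simp
  \<comment> \<open>\<open>YXs_eq\<close> at \<open>k = n\<close> identifies the middle factor of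
    \<open>hmap_zero\<close> with \<open>X_n\<close>.\<close>
  have T0: "\<Phi> (Hgen r n (HS 0)) =
      Ygen r n YXinv \<otimes>\<^bsub>Yaff r n\<^esub> YXs r n n \<otimes>\<^bsub>Yaff r n\<^esub>
      inv\<^bsub>Yaff r n\<^esub> (list_prod (Yaff r n) (map (\<lambda>i. Ygen r n (YG i)) (rev [1..<n] @ [2..<n])))"
    if "n \<ge> 2"
    using Y.hmap_zero[OF that] \<Phi>_gen[of "HS 0"] that YXs_eq[OF Y.yokonuma_rep_axioms assms(2)]
    by (simp add: Y.gprod_def refl_indices_iff)
  have iso: "\<Phi> \<in> algebra_iso (laurent_ring r) (Haff r n) (Yaff r n)"
    "\<Psi> \<in> algebra_iso (laurent_ring r) (Yaff r n) (Haff r n)"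
    using algebra_iso_if_inverse[OF \<Phi> \<Psi> \<Psi>\<Phi> \<Phi>\<Psi>] algebra_iso_if_inverse[OF \<Psi> \<Phi> \<Phi>\<Psi> \<Psi>\<Phi>] by simp_all
  have rho: "\<Phi> (Hgen r n HRho) =
      list_prod (Yaff r n) (map (\<lambda>i. Ygen r n (YG i)) (rev [1..<n])) \<otimes>\<^bsub>Yaff r n\<^esub> Ygen r n YX"
    "\<Phi> (Hgen r n HRhoinv) = Ygen r n YXinv \<otimes>\<^bsub>Yaff r n\<^esub>
      list_prod (Yaff r n) (map (\<lambda>i. inv\<^bsub>Yaff r n\<^esub> Ygen r n (YG i)) [1..<n])"
    subgoal using \<Phi>_gen[of HRho] by (simp add: Y.hmap_simps Y.rho_def Y.gprod_def)
    subgoal using \<Phi>_gen[of HRhoinv] Y.inv_rho by (simp add: Y.hmap_simps)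
    done
  have X: "\<Psi> (Ygen r n YX) =
      list_prod (Haff r n) (map (\<lambda>i. inv\<^bsub>Haff r n\<^esub> Hgen r n (HS i)) [1..<n])
      \<otimes>\<^bsub>Haff r n\<^esub> Hgen r n HRho"
    "\<Psi> (Ygen r n YXinv) = Hgen r n HRhoinv \<otimes>\<^bsub>Haff r n\<^esub>
      list_prod (Haff r n) (map (\<lambda>i. Hgen r n (HS i)) (rev [1..<n]))"
    using \<Psi>_gen H.X_def H.inv_X by (simp_all add: H.gprod_def)
  have t: "\<Phi> (Hgen r n (HT j)) = Ygen r n (YT j)" "\<Psi> (Ygen r n (YT j)) = Hgen r n (HT j)"
    if "j \<in> {1..n}" for j
    using that \<Phi>_gen \<Psi>_gen by (simp_all add: Y.hmap_simps)
  show ?thesis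
    by (intro exI[of _ \<Phi>] exI[of _ \<Psi>] conjI ballI impI)
      (assumption | rule iso \<Psi>\<Phi> \<Phi>\<Psi> t \<Phi>_s T0 rho \<Psi>_g X)+
qed

end
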